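(* Let $I=[0,1]$ or $I=[0,\infty)$. The space $Ces_\infty(I)$ is isomorphic to the space $(\bigoplus_{k=1}^\infty\mathcal M[0,1])_{l_\infty}$.
   Context: $Ces_\infty(I)$ is the space of measurable functions $f$ on $I$ with $\|f\|=\sup_{x\in I,x>0}\frac1x\int_0^x|f(t)|\,dt<\infty$. $\mathcal M[0,1]$ is the Banach space of regular Borel (signed) measures on $[0,1]$ of finite variation with the total variation norm. $(\bigoplus_{k}X_k)_{l_\infty}$ is the space of sequences $(x_k)$, $x_k\in X_k$, with $\sup_k\|x_k\|<\infty$, normed by this supremum. *)

theory Defs
  imports "HOL-Analysis.Analysis"
begin

text \<open>Elements of Ces_infinity(I) are represented by measurable functions on I
  (real-valued); the (semi)norm vanishes exactly on functions that are zero a.e. on I,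
  so working with the seminorm on functions is equivalent to working on the quotient.\<close>

definition ces_norm :: "real set \<Rightarrow> (real \<Rightarrow> real) \<Rightarrow> ennreal" where
  "ces_norm I f = (SUP x\<in>{x\<in>I. 0 < x}.
      ennreal (1 / x) * (\<integral>\<^sup>+ t \<in> {0..x}. ennreal \<bar>f t\<bar> \<partial>lebesgue))"

definition Ces_inf :: "real set \<Rightarrow> (real \<Rightarrow> real) set" where
  "Ces_inf I = {f. f \<in> borel_measurable (restrict_space lebesgue I) \<and> ces_norm I f < \<infinity>}"

definition borel01 :: "real set set" where
  "borel01 = {A. A \<in> sets borel \<and> A \<subseteq> {0..1}}"

definition var_on :: "(real set \<Rightarrow> real) \<Rightarrow> real set \<Rightarrow> ennreal" where
  "var_on \<nu> A = (SUP P\<in>{P. finite P \<and> P \<subseteq> borel01 \<and> disjoint P \<and> \<Union>P \<subseteq> A}.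
      (\<Sum>B\<in>P. ennreal \<bar>\<nu> B\<bar>))"

definition tv_norm :: "(real set \<Rightarrow> real) \<Rightarrow> ennreal" where
  "tv_norm \<nu> = var_on \<nu> {0..1}"

text \<open>A signed measure on the Borel sets of [0,1] (set to 0 on all other sets, so the
  representation is unique), countably additive, of finite variation and regular.\<close>
definition signed_measure01 :: "(real set \<Rightarrow> real) \<Rightarrow> bool" where
  "signed_measure01 \<nu> \<longleftrightarrow>
     (\<forall>A. A \<notin> borel01 \<longrightarrow> \<nu> A = 0) \<and>
     (\<forall>F::nat \<Rightarrow> real set. range F \<subseteq> borel01 \<and> disjoint_family F \<longrightarrow>
         (\<lambda>n. \<nu> (F n)) sums \<nu> (\<Union>n. F n)) \<and>
     tv_norm \<nu> < \<infinity> \<and>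
     (\<forall>A\<in>borel01. \<forall>e>0. \<exists>K U. compact K \<and> K \<subseteq> A \<and> open U \<and> A \<subseteq> U \<and>
         var_on \<nu> ((U \<inter> {0..1}) - K) < ennreal e)"

definition linf_norm :: "(nat \<Rightarrow> real set \<Rightarrow> real) \<Rightarrow> ennreal" where
  "linf_norm \<mu> = (SUP k. tv_norm (\<mu> k))"

definition linf_M01 :: "(nat \<Rightarrow> real set \<Rightarrow> real) set" where
  "linf_M01 = {\<mu>. (\<forall>k. signed_measure01 (\<mu> k)) \<and> linf_norm \<mu> < \<infinity>}"

end

theory Submission
  imports Defs "HOL-Library.Function_Algebras" "HOL-Library.Nat_Bijection"
begin

text \<open>Cutting the half-line into dyadic blocks and dilating each block to the unit interval, one
  sees that \<open>Ces_\<infinity>\<close> is the \<open>l_\<infinity>\<close>-sum \<open>X\<close> of copies of \<open>L_1[0,1]\<close>, that is, of the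
  absolutely continuous measures on \<open>[0,1]\<close>.  Let \<open>Y\<close> be the \<open>l_\<infinity>\<close>-sum of copies of \<open>M[0,1]\<close>.
  The Lebesgue decomposition makes \<open>X\<close> complemented in \<open>Y\<close>.  Conversely, \<open>M[0,1]\<close> is complemented
  in \<open>X\<close>: a measure is sent to the sequence of its averages over finer and finer partitions, and
  weak* limits along an ultrafilter give a left inverse.  As \<open>X\<close> and \<open>Y\<close> are isomorphic to
  their own \<open>l_\<infinity>\<close>-sums, Pelczynski's decomposition method shows that they are isomorphic.\<close>

section \<open>Extended norms and the decomposition method\<close>

text \<open>The summands cannot be matched one by one: \<open>L_1[0,1]\<close> is separable and
  \<open>M[0,1]\<close> is not, so only a decomposition argument compares the two sums. The averages
  of a singular measure do not converge in variation, since a norm limit of absolutely continuous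
  measures is absolutely continuous; they determine the measure only through weak* limits. This is
  why a single measure is spread over a whole sequence, and why one fixed ultrafilter is used: along
  it every bounded sequence has a limit, and the limit is linear.

  The mean over \<open>{0..x}\<close> is controlled by the dyadic blocks because the lengths of the
  blocks below \<open>x\<close> form a geometric series; the Cesaro norm and the supremum over the
  blocks then bound each other up to the factor 2. Both choices of the interval give countably
  infinitely many blocks, hence the same sum.

  With \<open>L_1\<close> represented by absolutely continuous measures, equality of set functions
  replaces equality almost everywhere, and both sums live in the same ambient type.\<close>

instantiation "fun" :: (type, real_vector) real_vector
begin

definition scaleR_fun :: "real \<Rightarrow> ('a \<Rightarrow> 'b) \<Rightarrow> 'a \<Rightarrow> 'b" where
  "scaleR_fun a f = (\<lambda>x. a *\<^sub>R f x)"

instance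
  by standard (auto simp: scaleR_fun_def fun_eq_iff scaleR_add_right scaleR_add_left)

end

lemma scaleR_fun_apply [simp]: "(a *\<^sub>R f) x = a *\<^sub>R f x"
  by (simp add: scaleR_fun_def)

text \<open>A normed space is encoded by a norm with values in \<open>[0, \<infinity>]\<close> on an ambient vector space; its
  elements are the vectors of finite norm.\<close>

definition ext_norm :: "('a::real_vector \<Rightarrow> ennreal) \<Rightarrow> bool" where
  "ext_norm N \<longleftrightarrow> (\<forall>x y. N (x + y) \<le> N x + N y) \<and> (\<forall>a x. N (a *\<^sub>R x) \<le> ennreal \<bar>a\<bar> * N x)"

text \<open>Linearity and the bound are asked only of vectors of finite norm: \<open>ac_part\<close>
  and the limit operator in \<open>complemented_M_linf_ac\<close> rest on choices that mean nothing
  for other set functions.\<close>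

definition bounded_op :: "('a::real_vector \<Rightarrow> ennreal) \<Rightarrow> ('b::real_vector \<Rightarrow> ennreal) \<Rightarrow> ('a \<Rightarrow> 'b) \<Rightarrow> bool" where
  "bounded_op N N' T \<longleftrightarrow>
     (\<forall>x y. N x < \<infinity> \<longrightarrow> N y < \<infinity> \<longrightarrow> T (x + y) = T x + T y) \<and>
     (\<forall>a x. N x < \<infinity> \<longrightarrow> T (a *\<^sub>R x) = a *\<^sub>R T x) \<and>
     (\<exists>C::real. 0 \<le> C \<and> (\<forall>x. N x < \<infinity> \<longrightarrow> N' (T x) \<le> ennreal C * N x))"

definition isomorphic :: "('a::real_vector \<Rightarrow> ennreal) \<Rightarrow> ('b::real_vector \<Rightarrow> ennreal) \<Rightarrow> bool" where
  "isomorphic N N' \<longleftrightarrow> (\<exists>T S. bounded_op N N' T \<and> bounded_op N' N S \<and>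
     (\<forall>x. N x < \<infinity> \<longrightarrow> S (T x) = x) \<and> (\<forall>y. N' y < \<infinity> \<longrightarrow> T (S y) = y))"

definition complemented :: "('b::real_vector \<Rightarrow> ennreal) \<Rightarrow> ('a::real_vector \<Rightarrow> ennreal) \<Rightarrow> bool" where
  "complemented N' N \<longleftrightarrow> (\<exists>A B. bounded_op N' N A \<and> bounded_op N N' B \<and> (\<forall>y. N' y < \<infinity> \<longrightarrow> B (A y) = y))"

definition linf :: "('a::real_vector \<Rightarrow> ennreal) \<Rightarrow> (nat \<Rightarrow> 'a) \<Rightarrow> ennreal" where
  "linf N x = (SUP k. N (x k))"

definition prod_norm :: "('a::real_vector \<Rightarrow> ennreal) \<Rightarrow> ('b::real_vector \<Rightarrow> ennreal) \<Rightarrow> 'a \<times> 'b \<Rightarrow> ennreal" where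
  "prod_norm N N' z = max (N (fst z)) (N' (snd z))"

lemma ext_norm_add: "ext_norm N \<Longrightarrow> N (x + y) \<le> N x + N y"
  and ext_norm_scaleR: "ext_norm N \<Longrightarrow> N (a *\<^sub>R x) \<le> ennreal \<bar>a\<bar> * N x"
  by (auto simp: ext_norm_def)

lemma ext_norm_add_finite: "ext_norm N \<Longrightarrow> N x < \<infinity> \<Longrightarrow> N y < \<infinity> \<Longrightarrow> N (x + y) < \<infinity>"
  by (rule order_le_less_trans[OF ext_norm_add]) auto

lemma ext_norm_scaleR_finite: "ext_norm N \<Longrightarrow> N x < \<infinity> \<Longrightarrow> N (a *\<^sub>R x) < \<infinity>"
  by (rule order_le_less_trans[OF ext_norm_scaleR]) (auto simp: ennreal_mult_less_top)

lemma bounded_opI: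
  assumes "\<And>x y. N x < \<infinity> \<Longrightarrow> N y < \<infinity> \<Longrightarrow> T (x + y) = T x + T y"
    and "\<And>a x. N x < \<infinity> \<Longrightarrow> T (a *\<^sub>R x) = a *\<^sub>R T x"
    and "0 \<le> (C::real)" "\<And>x. N x < \<infinity> \<Longrightarrow> N' (T x) \<le> ennreal C * N x"
  shows "bounded_op N N' T"
  using assms unfolding bounded_op_def by blast

lemma bounded_op_add: "bounded_op N N' T \<Longrightarrow> N x < \<infinity> \<Longrightarrow> N y < \<infinity> \<Longrightarrow> T (x + y) = T x + T y"
  and bounded_op_scaleR: "bounded_op N N' T \<Longrightarrow> N x < \<infinity> \<Longrightarrow> T (a *\<^sub>R x) = a *\<^sub>R T x"
  by (auto simp: bounded_op_def)

lemma bounded_op_diff: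
  assumes "bounded_op N N' T" "ext_norm N" "N x < \<infinity>" "N y < \<infinity>"
  shows "T (x - y) = T x - T y"
  using bounded_op_add[OF assms(1,3), of "(-1) *\<^sub>R y"] bounded_op_scaleR[OF assms(1,4), of "-1"]
    ext_norm_scaleR_finite[OF assms(2,4), of "-1"]
  by simp

lemma bounded_op_bound:
  assumes "bounded_op N N' T"
  obtains C :: real where "0 \<le> C" "\<And>x. N x < \<infinity> \<Longrightarrow> N' (T x) \<le> ennreal C * N x"
  using assms unfolding bounded_op_def by blast

lemma bounded_op_finite: "bounded_op N N' T \<Longrightarrow> N x < \<infinity> \<Longrightarrow> N' (T x) < \<infinity>"
  by (elim bounded_op_bound) (metis ennreal_less_top ennreal_mult_less_top infinity_ennreal_def order_le_less_trans)

lemma bounded_op_comp: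
  assumes T: "bounded_op N N' T" and S: "bounded_op N' N'' S"
  shows "bounded_op N N'' (\<lambda>x. S (T x))"
proof -
  obtain C where C: "0 \<le> C" "\<And>x. N x < \<infinity> \<Longrightarrow> N' (T x) \<le> ennreal C * N x" using bounded_op_bound[OF T] by metis
  obtain D where D: "0 \<le> D" "\<And>x. N' x < \<infinity> \<Longrightarrow> N'' (S x) \<le> ennreal D * N' x" using bounded_op_bound[OF S] by metis
  show ?thesis
  proof (rule bounded_opI[where C = "D * C"])
    fix x assume x: "N x < \<infinity>"
    have "N'' (S (T x)) \<le> ennreal D * N' (T x)" using D bounded_op_finite[OF T x] by auto
    also have "\<dots> \<le> ennreal D * (ennreal C * N x)" using C x by (intro mult_left_mono) auto
    finally show "N'' (S (T x)) \<le> ennreal (D * C) * N x" using C D by (simp add: ennreal_mult mult.assoc)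
  qed (use C D in \<open>auto simp: bounded_op_add[OF T] bounded_op_scaleR[OF T] bounded_op_add[OF S] bounded_op_scaleR[OF S] bounded_op_finite[OF T, simplified]\<close>)
qed

lemma bounded_op_sum:
  assumes T: "bounded_op N N' T" and S: "bounded_op N N' S" and N': "ext_norm N'"
  shows "bounded_op N N' (\<lambda>x. T x + S x)"
proof -
  obtain C where C: "0 \<le> C" "\<And>x. N x < \<infinity> \<Longrightarrow> N' (T x) \<le> ennreal C * N x" using bounded_op_bound[OF T] by metis
  obtain D where D: "0 \<le> D" "\<And>x. N x < \<infinity> \<Longrightarrow> N' (S x) \<le> ennreal D * N x" using bounded_op_bound[OF S] by metis
  show ?thesis
  proof (rule bounded_opI[where C = "C + D"])
    fix x assume x: "N x < \<infinity>"
    have "N' (T x + S x) \<le> N' (T x) + N' (S x)" by (rule ext_norm_add[OF N'])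
    also have "\<dots> \<le> ennreal C * N x + ennreal D * N x" using C D x by (intro add_mono) auto
    finally show "N' (T x + S x) \<le> ennreal (C + D) * N x" using C D by (simp add: distrib_right)
  qed (use C D in \<open>auto simp: bounded_op_add[OF T] bounded_op_scaleR[OF T] bounded_op_add[OF S] bounded_op_scaleR[OF S] scaleR_add_right\<close>)
qed

lemma bounded_op_id: "bounded_op N N (\<lambda>x. x)"
  by (rule bounded_opI[where C = 1]) auto

lemma bounded_op_minus:
  assumes T: "bounded_op N N' T" and N': "ext_norm N'"
  shows "bounded_op N N' (\<lambda>x. - T x)"
proof -
  have "bounded_op N' N' uminus"
    by (rule bounded_opI[where C = 1]) (use ext_norm_scaleR[OF N', of "-1"] in auto)
  from bounded_op_comp[OF T this] show ?thesis .
qed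

lemma linf_nth_le: "N (x k) \<le> linf N x"
  unfolding linf_def by (rule SUP_upper) simp

lemma linf_nth_finite: "linf N x < \<infinity> \<Longrightarrow> N (x k) < \<infinity>"
  using linf_nth_le order_le_less_trans by blast

lemma linf_leI: "(\<And>k. N (x k) \<le> c) \<Longrightarrow> linf N x \<le> c"
  unfolding linf_def by (rule SUP_least) simp

lemma ext_norm_linf: "ext_norm N \<Longrightarrow> ext_norm (linf N)"
  unfolding ext_norm_def[of "linf N"]
proof (intro conjI allI)
  fix x y :: "nat \<Rightarrow> 'a" assume N: "ext_norm N"
  show "linf N (x + y) \<le> linf N x + linf N y"
    by (rule linf_leI) (auto intro: order_trans[OF ext_norm_add[OF N]] add_mono linf_nth_le)
next
  fix x :: "nat \<Rightarrow> 'a" and a assume N: "ext_norm N"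
  show "linf N (a *\<^sub>R x) \<le> ennreal \<bar>a\<bar> * linf N x"
    by (rule linf_leI, simp) (rule order_trans[OF ext_norm_scaleR[OF N] mult_left_mono[OF linf_nth_le]], simp)
qed

lemma bounded_op_fst: "bounded_op (prod_norm N N') N fst" and bounded_op_snd: "bounded_op (prod_norm N N') N' snd"
  by (rule bounded_opI[where C = 1]; simp add: prod_norm_def)+

lemma bounded_op_nth: "bounded_op (linf N) N (\<lambda>x. x k)"
  by (rule bounded_opI[where C = 1]) (auto simp: linf_nth_le)

lemma bounded_op_Pair:
  assumes T: "bounded_op N N' T" and S: "bounded_op N N'' S"
  shows "bounded_op N (prod_norm N' N'') (\<lambda>x. (T x, S x))"
proof -
  obtain C where C: "0 \<le> C" "\<And>x. N x < \<infinity> \<Longrightarrow> N' (T x) \<le> ennreal C * N x" using bounded_op_bound[OF T] by metis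
  obtain D where D: "0 \<le> D" "\<And>x. N x < \<infinity> \<Longrightarrow> N'' (S x) \<le> ennreal D * N x" using bounded_op_bound[OF S] by metis
  have "N' (T x) \<le> ennreal (C + D) * N x" "N'' (S x) \<le> ennreal (C + D) * N x" if "N x < \<infinity>" for x
    using C D that by (auto intro!: order_trans[OF C(2)[OF that]] order_trans[OF D(2)[OF that]] mult_right_mono ennreal_leI)
  then show ?thesis
    by (intro bounded_opI[where C = "C + D"])
      (use C D in \<open>auto simp: bounded_op_add[OF T] bounded_op_scaleR[OF T] bounded_op_add[OF S] bounded_op_scaleR[OF S] prod_norm_def\<close>)
qed

lemma bounded_op_linf_lift:
  assumes "0 \<le> (C::real)"
    and "\<And>k x y. N x < \<infinity> \<Longrightarrow> N y < \<infinity> \<Longrightarrow> T k (x + y) = T k x + T k y"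
    and "\<And>k a x. N x < \<infinity> \<Longrightarrow> T k (a *\<^sub>R x) = a *\<^sub>R T k x"
    and "\<And>k x. N x < \<infinity> \<Longrightarrow> N' (T k x) \<le> ennreal C * N x"
  shows "bounded_op N (linf N') (\<lambda>x k. T k x)"
  by (rule bounded_opI[where C = C]) (use assms in \<open>auto intro!: linf_leI simp: fun_eq_iff\<close>)

lemma bounded_op_map:
  assumes T: "bounded_op N N' T"
  shows "bounded_op (linf N) (linf N') (\<lambda>x k. T (x k))"
proof -
  obtain C where C: "0 \<le> C" "\<And>x. N x < \<infinity> \<Longrightarrow> N' (T x) \<le> ennreal C * N x" using bounded_op_bound[OF T] by metis
  show ?thesis
  proof (rule bounded_op_linf_lift[OF C(1)])
    fix k and x :: "nat \<Rightarrow> 'a" assume x: "linf N x < \<infinity>"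
    show "N' (T (x k)) \<le> ennreal C * linf N x"
      using linf_nth_finite[OF x]
      by (intro order_trans[OF C(2)] mult_left_mono linf_nth_le) auto
  qed (auto simp: bounded_op_add[OF T] bounded_op_scaleR[OF T] linf_nth_finite[simplified])
qed

lemma bounded_op_shift: "bounded_op (linf N) (linf N) (\<lambda>x k. x (Suc k))"
  by (rule bounded_op_linf_lift[where C = 1]) (auto simp: linf_nth_le)

lemma bounded_op_case_nat:
  assumes T: "bounded_op N N' T" and S: "bounded_op N (linf N') S"
  shows "bounded_op N (linf N') (\<lambda>x k. case k of 0 \<Rightarrow> T x | Suc j \<Rightarrow> S x j)"
proof -
  obtain C where C: "0 \<le> C" "\<And>x. N x < \<infinity> \<Longrightarrow> N' (T x) \<le> ennreal C * N x" using bounded_op_bound[OF T] by metis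
  obtain D where D: "0 \<le> D" "\<And>x. N x < \<infinity> \<Longrightarrow> linf N' (S x) \<le> ennreal D * N x" using bounded_op_bound[OF S] by metis
  have "N' (T x) \<le> ennreal (C + D) * N x" "N' (S x j) \<le> ennreal (C + D) * N x" if "N x < \<infinity>" for x j
    using C(1) D(1)
    by (intro order_trans[OF C(2)[OF that]] order_trans[OF linf_nth_le[of N' "S x" j] order_trans[OF D(2)[OF that]]]
        mult_right_mono ennreal_leI; simp)+
  then show ?thesis
    by (intro bounded_op_linf_lift[where C = "C + D"])
      (use C D in \<open>auto simp: bounded_op_add[OF T] bounded_op_scaleR[OF T] bounded_op_add[OF S] bounded_op_scaleR[OF S] split: nat.split\<close>)
qed

section \<open>Isomorphism and complementation\<close>

lemma isomorphic_sym: "isomorphic N N' \<Longrightarrow> isomorphic N' N"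
  unfolding isomorphic_def by metis

lemma isomorphic_trans:
  assumes "isomorphic N N'" "isomorphic N' N''"
  shows "isomorphic N N''"
proof -
  obtain T S where *: "bounded_op N N' T" "bounded_op N' N S" "\<And>x. N x < \<infinity> \<Longrightarrow> S (T x) = x" "\<And>x. N' x < \<infinity> \<Longrightarrow> T (S x) = x"
    using assms(1) unfolding isomorphic_def by metis
  obtain T' S' where **: "bounded_op N' N'' T'" "bounded_op N'' N' S'" "\<And>x. N' x < \<infinity> \<Longrightarrow> S' (T' x) = x" "\<And>x. N'' x < \<infinity> \<Longrightarrow> T' (S' x) = x"
    using assms(2) unfolding isomorphic_def by metis
  show ?thesis unfolding isomorphic_def
    by (intro exI[of _ "\<lambda>x. T' (T x)"] exI[of _ "\<lambda>x. S (S' x)"] conjI bounded_op_comp[OF *(1) **(1)] bounded_op_comp[OF **(2) *(2)])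
      (use * ** bounded_op_finite in metis)+
qed

lemma isomorphic_prod_swap: "isomorphic (prod_norm N N') (prod_norm N' N)"
  unfolding isomorphic_def
  by (intro exI[of _ "\<lambda>z. (snd z, fst z)"] conjI bounded_op_Pair bounded_op_fst bounded_op_snd) auto

lemma isomorphic_prod_left:
  assumes "isomorphic N N'"
  shows "isomorphic (prod_norm N M) (prod_norm N' M)"
proof -
  obtain T S where *: "bounded_op N N' T" "bounded_op N' N S" "\<And>x. N x < \<infinity> \<Longrightarrow> S (T x) = x" "\<And>x. N' x < \<infinity> \<Longrightarrow> T (S x) = x"
    using assms(1) unfolding isomorphic_def by metis
  show ?thesis unfolding isomorphic_def
    by (intro exI[of _ "\<lambda>z. (T (fst z), snd z)"] exI[of _ "\<lambda>z. (S (fst z), snd z)"] conjI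
        bounded_op_Pair bounded_op_comp[OF bounded_op_fst *(1)] bounded_op_comp[OF bounded_op_fst *(2)] bounded_op_snd)
      (use * in \<open>auto simp: prod_norm_def\<close>)
qed

lemma complemented_isomorphic:
  assumes "complemented N' N" "isomorphic N M"
  shows "complemented N' M"
proof -
  obtain A B where *: "bounded_op N' N A" "bounded_op N N' B" "\<And>y. N' y < \<infinity> \<Longrightarrow> B (A y) = y"
    using assms(1) unfolding complemented_def by metis
  obtain T S where **: "bounded_op N M T" "bounded_op M N S" "\<And>x. N x < \<infinity> \<Longrightarrow> S (T x) = x"
    using assms(2) unfolding isomorphic_def by metis
  show ?thesis unfolding complemented_def
    by (intro exI[of _ "\<lambda>x. T (A x)"] exI[of _ "\<lambda>x. B (S x)"] conjI bounded_op_comp[OF *(1) **(1)] bounded_op_comp[OF **(2) *(2)])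
      (use * ** bounded_op_finite in metis)
qed

lemma complemented_linf:
  assumes "complemented N' N"
  shows "complemented (linf N') (linf N)"
proof -
  obtain A B where *: "bounded_op N' N A" "bounded_op N N' B" "\<And>y. N' y < \<infinity> \<Longrightarrow> B (A y) = y"
    using assms(1) unfolding complemented_def by metis
  show ?thesis unfolding complemented_def
    by (intro exI[of _ "\<lambda>x k. A (x k)"] exI[of _ "\<lambda>x k. B (x k)"] conjI bounded_op_map *(1,2))
      (use *(3) linf_nth_finite in blast)
qed

lemma isomorphic_linf_linf: "isomorphic (linf (linf N)) (linf N)"
  unfolding isomorphic_def
proof (intro exI conjI allI impI)
  show "bounded_op (linf (linf N)) (linf N) (\<lambda>x k. x (fst (prod_decode k)) (snd (prod_decode k)))"
    by (rule bounded_op_linf_lift[where C = 1]) (auto intro: order_trans[OF linf_nth_le linf_nth_le])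
  show "bounded_op (linf N) (linf (linf N)) (\<lambda>x i j. x (prod_encode (i, j)))"
    by (rule bounded_opI[where C = 1]) (auto intro!: linf_leI linf_nth_le simp: fun_eq_iff)
qed auto

text \<open>Write \<open>P = A B\<close> for the projection of \<open>N\<close> onto the copy of \<open>N'\<close>.  The isomorphism shifts the
  \<open>P\<close>-components of a sequence down by one place, and thereby sets the component of index \<open>0\<close> free.\<close>

lemma isomorphic_linf_prod_complemented:
  assumes N: "ext_norm N" and c: "complemented N' N"
  shows "isomorphic (linf N) (prod_norm (linf N) N')"
proof -
  obtain A B where A: "bounded_op N' N A" and B: "bounded_op N N' B" and BA: "\<And>y. N' y < \<infinity> \<Longrightarrow> B (A y) = y"
    using c unfolding complemented_def by metis
  define P where "P x = A (B x)" for x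
  define Q where "Q x = x - P x" for x
  have P: "bounded_op N N P" unfolding P_def by (rule bounded_op_comp[OF B A])
  have "bounded_op N N (\<lambda>x. x + - P x)" by (intro bounded_op_sum bounded_op_id bounded_op_minus P N)
  then have Q: "bounded_op N N Q" by (simp add: Q_def[abs_def])
  have PP: "P (P x) = P x" if "N x < \<infinity>" for x
    using that by (simp add: P_def BA bounded_op_finite[OF B, simplified])
  have PQ: "P (Q x) = 0" if "N x < \<infinity>" for x
    using that unfolding Q_def by (subst bounded_op_diff[OF P N]) (auto simp: PP bounded_op_finite[OF P, simplified])
  have QP: "Q (P x) = 0" if "N x < \<infinity>" for x
    using that unfolding Q_def by (simp add: PP)
  have QQ: "Q (Q x) = Q x" if "N x < \<infinity>" for x
    using that PQ[OF that] by (simp add: Q_def)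
  have PQ': "P x + Q x = x" "Q x + P x = x" for x by (auto simp: Q_def)
  have BP: "B (P x) = B x" if "N x < \<infinity>" for x
    using that by (simp add: P_def BA bounded_op_finite[OF B, simplified])
  have BQ: "B (Q x) = 0" if "N x < \<infinity>" for x
    using that unfolding Q_def by (subst bounded_op_diff[OF B N]) (auto simp: BP bounded_op_finite[OF P, simplified])
  have PA: "P (A y) = A y" "Q (A y) = 0" if "N' y < \<infinity>" for y
    using that by (auto simp: P_def BA Q_def)
  note fin = bounded_op_finite[OF P, simplified] bounded_op_finite[OF Q, simplified] bounded_op_finite[OF A, simplified]
  define U where "U x = ((\<lambda>k. P (x (Suc k)) + Q (x k)), B (x 0))" for x :: "nat \<Rightarrow> 'a"
  define V where "V z = (\<lambda>k. case k of 0 \<Rightarrow> A (snd z) + Q (fst z 0)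
      | Suc j \<Rightarrow> P (fst z j) + Q (fst z (Suc j)))" for z :: "(nat \<Rightarrow> 'a) \<times> 'b"
  have "bounded_op (linf N) (linf N) (\<lambda>x. (\<lambda>k. P (x (Suc k))) + (\<lambda>k. Q (x k)))"
    by (intro bounded_op_sum bounded_op_map bounded_op_comp[OF bounded_op_shift bounded_op_map[OF P]] Q ext_norm_linf N)
  then have U: "bounded_op (linf N) (prod_norm (linf N) N') U"
    unfolding U_def[abs_def] by (intro bounded_op_Pair bounded_op_comp[OF bounded_op_nth B]) (simp add: plus_fun_def)
  have "bounded_op (linf N) (linf N) (\<lambda>x. (\<lambda>k. P (x k)) + (\<lambda>k. Q (x (Suc k))))"
    by (intro bounded_op_sum bounded_op_map bounded_op_comp[OF bounded_op_shift bounded_op_map[OF Q]] P ext_norm_linf N)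
  from bounded_op_comp[OF bounded_op_fst this]
  have V: "bounded_op (prod_norm (linf N) N') (linf N) V"
    unfolding V_def[abs_def]
    by (intro bounded_op_case_nat bounded_op_sum bounded_op_comp[OF bounded_op_snd A] bounded_op_comp[OF bounded_op_fst bounded_op_comp[OF bounded_op_nth Q]] N)
      (simp add: plus_fun_def)
  have VU: "V (U x) = x" if "linf N x < \<infinity>" for x
  proof
    fix k
    have f: "N (x k) < top" for k using linf_nth_finite[OF that] by simp
    have Qx: "Q (P (x (Suc k)) + Q (x k)) = Q (x k)" for k
      by (subst bounded_op_add[OF Q]) (simp_all add: f fin QP QQ)
    have Px: "P (P (x (Suc k)) + Q (x k)) = P (x (Suc k))" for k
      by (subst bounded_op_add[OF P]) (simp_all add: f fin PP PQ)
    show "V (U x) k = x k"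
      by (cases k) (simp_all add: U_def V_def Qx Px PQ' flip: P_def)
  qed
  have UV: "U (V z) = z" if "prod_norm (linf N) N' z < \<infinity>" for z
  proof -
    obtain x y where z: "z = (x, y)" by (cases z)
    have fx: "N (x k) < top" and fy: "N' y < top" for k
      using that linf_nth_finite[of N x k] by (simp_all add: z prod_norm_def)
    have "P (V z (Suc k)) = P (x k)" for k
      unfolding V_def z by (simp, subst bounded_op_add[OF P]) (simp_all add: fx fin PP PQ)
    moreover have "Q (V z k) = Q (x k)" for k
      unfolding V_def z by (cases k; simp; subst bounded_op_add[OF Q]) (simp_all add: fx fy fin QP QQ PA)
    moreover have "B (V z 0) = y"
      unfolding V_def z by (simp, subst bounded_op_add[OF B]) (simp_all add: fx fy fin BA BQ)
    ultimately show ?thesis by (simp add: U_def PQ' z)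
  qed
  show ?thesis unfolding isomorphic_def
    by (intro exI[of _ U] exI[of _ V] conjI allI impI U V UV VU)
qed

text \<open>Since \<open>linf K\<close> is isomorphic to \<open>linf (linf K)\<close>, a space
  \<open>L\<close> complemented in \<open>linf K\<close> sits in each of infinitely many copies of
  it, so the shift of \<open>isomorphic_linf_prod_complemented\<close> lets \<open>linf K\<close>
  absorb \<open>L\<close>. Absorption on both sides gives X ~ X + Y ~ Y + X ~ Y.\<close>

theorem linf_decomposition:
  fixes N :: "'a::real_vector \<Rightarrow> ennreal" and N' :: "'b::real_vector \<Rightarrow> ennreal"
  assumes "ext_norm N" "ext_norm N'" "complemented (linf N') (linf N)" "complemented (linf N) (linf N')"
  shows "isomorphic (linf N) (linf N')"
proof -
  \<comment> \<open>\<open>K\<close> and \<open>L\<close> have type variables of their own, so that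
    the fact serves for both orders of the two spaces.\<close>
  have *: "isomorphic (linf K) (prod_norm (linf K) L)"
    if "ext_norm K" "complemented L (linf K)"
    for K :: "'c::real_vector \<Rightarrow> ennreal" and L :: "'d::real_vector \<Rightarrow> ennreal"
  proof -
    have "isomorphic (linf (linf K)) (prod_norm (linf (linf K)) L)"
      by (rule isomorphic_linf_prod_complemented[OF ext_norm_linf[OF that(1)] that(2)])
    from isomorphic_trans[OF isomorphic_trans[OF isomorphic_sym[OF isomorphic_linf_linf] this]
        isomorphic_prod_left[OF isomorphic_linf_linf]]
    show ?thesis .
  qed
  show ?thesis
    by (rule isomorphic_trans[OF isomorphic_trans[OF *[OF assms(1,3)] isomorphic_prod_swap]
          isomorphic_sym[OF *[OF assms(2,4)]]])
qed

section \<open>Signed measures on the unit interval\<close>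

lemma borel01_empty [simp]: "{} \<in> borel01"
  and borel01_Int: "A \<in> borel01 \<Longrightarrow> B \<in> sets borel \<Longrightarrow> A \<inter> B \<in> borel01"
  and borel01_Diff: "A \<in> borel01 \<Longrightarrow> B \<in> sets borel \<Longrightarrow> A - B \<in> borel01"
  and borel01_Un: "A \<in> borel01 \<Longrightarrow> B \<in> borel01 \<Longrightarrow> A \<union> B \<in> borel01"
  and borel01_UN: "(\<And>i::nat. F i \<in> borel01) \<Longrightarrow> (\<Union>i. F i) \<in> borel01"
  and borel01_Int_Icc: "B \<in> sets borel \<Longrightarrow> B \<inter> {0..1} \<in> borel01"
  and borel01_sets: "A \<in> borel01 \<Longrightarrow> A \<in> sets borel"
  and borel01_subset: "A \<in> borel01 \<Longrightarrow> A \<subseteq> {0..1}"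
  and borel01_Icc [simp]: "{0..1} \<in> borel01"
  by (auto simp: borel01_def)

text \<open>Regularity is left out here, since on the line it follows from the remaining properties.\<close>

definition finite_signed01 :: "(real set \<Rightarrow> real) \<Rightarrow> bool" where
  "finite_signed01 \<nu> \<longleftrightarrow>
     (\<forall>A. A \<notin> borel01 \<longrightarrow> \<nu> A = 0) \<and>
     (\<forall>F::nat \<Rightarrow> real set. range F \<subseteq> borel01 \<and> disjoint_family F \<longrightarrow>
         (\<lambda>n. \<nu> (F n)) sums \<nu> (\<Union>n. F n)) \<and>
     tv_norm \<nu> < \<infinity>"

lemma signed_measure01_imp_finite_signed01: "signed_measure01 \<nu> \<Longrightarrow> finite_signed01 \<nu>"
  by (auto simp: signed_measure01_def finite_signed01_def)

lemma finite_signed01_outside: "finite_signed01 \<nu> \<Longrightarrow> A \<notin> borel01 \<Longrightarrow> \<nu> A = 0"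
  and finite_signed01_sums: "finite_signed01 \<nu> \<Longrightarrow> (\<And>i::nat. F i \<in> borel01) \<Longrightarrow> disjoint_family F \<Longrightarrow>
    (\<lambda>n. \<nu> (F n)) sums \<nu> (\<Union>n. F n)"
  and finite_signed01_tv: "finite_signed01 \<nu> \<Longrightarrow> tv_norm \<nu> < \<infinity>"
  by (auto simp: finite_signed01_def image_subset_iff)

text \<open>A constant series converges only if its term is 0.\<close>

lemma finite_signed01_empty: assumes "finite_signed01 \<nu>" shows "\<nu> {} = 0"
proof -
  have "(\<lambda>n::nat. \<nu> {}) sums \<nu> (\<Union>n::nat. {})"
    by (rule finite_signed01_sums[OF assms]) (auto simp: disjoint_family_on_def)
  then have "summable (\<lambda>n::nat. \<nu> {})" by (rule sums_summable)
  then show ?thesis by (simp add: summable_const_iff)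
qed

lemma finite_signed01_Un:
  assumes \<nu>: "finite_signed01 \<nu>" and "A \<in> borel01" "B \<in> borel01" "A \<inter> B = {}"
  shows "\<nu> (A \<union> B) = \<nu> A + \<nu> B"
proof -
  have "(\<lambda>n. \<nu> (binaryset A B n)) sums \<nu> (\<Union>n. binaryset A B n)"
    by (rule finite_signed01_sums[OF \<nu>])
      (use assms in \<open>auto simp: binaryset_def disjoint_family_on_def\<close>)
  moreover have "(\<lambda>n. \<nu> (binaryset A B n)) sums (\<nu> A + \<nu> B)"
    by (rule binaryset_sums[where f = \<nu>]) (rule finite_signed01_empty[OF \<nu>])
  ultimately show ?thesis by (metis UN_binaryset_eq sums_unique2)
qed

lemma finite_signed01_Diff:
  assumes \<nu>: "finite_signed01 \<nu>" and "A \<in> borel01" "B \<in> borel01" "B \<subseteq> A"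
  shows "\<nu> (A - B) = \<nu> A - \<nu> B"
  using finite_signed01_Un[OF \<nu> assms(3) borel01_Diff[OF assms(2) borel01_sets[OF assms(3)]]] assms(4)
  by (simp add: Un_absorb1)

lemma disjoint_family_lessThan:
  fixes F :: "nat \<Rightarrow> 'a set"
  assumes "disjoint_family F"
  shows "(\<Union>i<n. F i) \<inter> F n = {}"
proof -
  have "F i \<inter> F n = {}" if "i < n" for i
    using disjoint_family_onD[OF assms, of i n] that by simp
  then show ?thesis by blast
qed

lemma finite_signed01_UN_lessThan:
  assumes \<nu>: "finite_signed01 \<nu>" and "\<And>i::nat. F i \<in> borel01" and "disjoint_family F"
  shows "\<nu> (\<Union>i<n. F i) = (\<Sum>i<n. \<nu> (F i))"
proof (induction n)
  case 0 show ?case by (simp add: finite_signed01_empty[OF \<nu>])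
next
  case (Suc n)
  have "(\<Union>i<n. F i) \<in> borel01" using assms(2) by (auto simp: borel01_def)
  moreover have "(\<Union>i<n. F i) \<inter> F n = {}" by (rule disjoint_family_lessThan[OF assms(3)])
  ultimately show ?case
    using finite_signed01_Un[OF \<nu> _ assms(2), of "\<Union>i<n. F i" n] Suc
    by (simp add: lessThan_Suc Un_commute add.commute)
qed

section \<open>The variation of a signed measure\<close>

lemma var_on_upper:
  assumes "finite P" "P \<subseteq> borel01" "disjoint P" "\<Union>P \<subseteq> A"
  shows "(\<Sum>B\<in>P. ennreal \<bar>\<nu> B\<bar>) \<le> var_on \<nu> A"
  unfolding var_on_def by (rule SUP_upper) (use assms in auto)

lemma var_on_least:
  assumes "\<And>P. finite P \<Longrightarrow> P \<subseteq> borel01 \<Longrightarrow> disjoint P \<Longrightarrow> \<Union>P \<subseteq> A \<Longrightarrow> (\<Sum>B\<in>P. ennreal \<bar>\<nu> B\<bar>) \<le> c"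
  shows "var_on \<nu> A \<le> c"
  unfolding var_on_def by (rule SUP_least) (use assms in auto)

lemma var_on_mono: "A \<subseteq> B \<Longrightarrow> var_on \<nu> A \<le> var_on \<nu> B"
  by (rule var_on_least, rule var_on_upper) auto

lemma abs_le_var_on: "B \<in> borel01 \<Longrightarrow> B \<subseteq> A \<Longrightarrow> ennreal \<bar>\<nu> B\<bar> \<le> var_on \<nu> A"
  using var_on_upper[of "{B}" A \<nu>] by simp

text \<open>\<open>var_on\<close> ranges over finite sets of sets, while here the sets are indexed.
  A disjoint family can repeat only the empty set, which is why \<open>\<nu> {} = 0\<close> is
  assumed.\<close>

lemma sum_abs_le_tv:
  assumes "\<And>i. i \<in> I \<Longrightarrow> F i \<in> borel01" "disjoint_family_on F I" "finite I" "\<nu> {} = 0"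
  shows "ennreal (\<Sum>i\<in>I. \<bar>\<nu> (F i)\<bar>) \<le> tv_norm \<nu>"
proof -
  have "ennreal (\<Sum>i\<in>I. \<bar>\<nu> (F i)\<bar>) = (\<Sum>i\<in>I. ennreal \<bar>\<nu> (F i)\<bar>)"
    by (simp add: sum_ennreal)
  also have "\<dots> = (\<Sum>B\<in>F ` I. ennreal \<bar>\<nu> B\<bar>)"
  proof (subst sum.reindex_nontrivial)
    fix x y assume *: "x \<in> I" "y \<in> I" "x \<noteq> y" "F x = F y"
    then have "F x = {}" using disjoint_family_onD[OF assms(2) *(1,2,3)] by simp
    then show "ennreal \<bar>\<nu> (F x)\<bar> = 0" by (simp add: assms(4))
  qed (use assms in auto)
  also have "\<dots> \<le> tv_norm \<nu>"
    unfolding tv_norm_def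
    by (rule var_on_upper)
      (use assms(1,3) in \<open>simp_all add: disjoint_family_on_disjoint_image[OF assms(2)] image_subset_iff
        UN_least borel01_subset\<close>)
  finally show ?thesis .
qed

text \<open>Families inside \<open>A\<close> and inside \<open>B\<close> join to one inside the
  union; the only set they can share is empty and contributes nothing. The two suprema are then
  taken one at a time.\<close>

lemma var_on_superadditive:
  assumes \<nu>: "\<nu> {} = 0" and "A \<inter> B = {}"
  shows "var_on \<nu> A + var_on \<nu> B \<le> var_on \<nu> (A \<union> B)"
proof -
  let ?S = "\<lambda>A. {P. finite P \<and> P \<subseteq> borel01 \<and> disjoint P \<and> \<Union>P \<subseteq> A}"
  let ?f = "\<lambda>P. \<Sum>B\<in>P. ennreal \<bar>\<nu> B\<bar>"
  have ne: "?S A \<noteq> {}" for A by (auto intro!: exI[of _ "{}"])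
  have "?f P + ?f Q \<le> var_on \<nu> (A \<union> B)" if "P \<in> ?S A" "Q \<in> ?S B" for P Q
  proof -
    have disj: "p \<inter> q = {}" if "p \<in> P" "q \<in> Q" for p q
      using that \<open>P \<in> ?S A\<close> \<open>Q \<in> ?S B\<close> assms(2) by blast
    have "?f P + ?f Q = ?f (P \<union> Q)"
      by (rule sum.union_inter_neutral[symmetric])
        (use that disj \<nu> in \<open>auto dest!: disj\<close>)
    also have "\<dots> \<le> var_on \<nu> (A \<union> B)"
      using that disj by (intro var_on_upper disjoint_union) auto
    finally show ?thesis .
  qed
  then have "?f P + var_on \<nu> B \<le> var_on \<nu> (A \<union> B)" if "P \<in> ?S A" for P
    unfolding var_on_def[of \<nu> B] using that
    by (subst ennreal_SUP_add_right[OF ne]) (auto intro!: SUP_least)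
  then show ?thesis
    unfolding var_on_def[of \<nu> A]
    by (subst ennreal_SUP_add_left[OF ne, symmetric]) (auto intro!: SUP_least)
qed

lemma ennreal_abs_sums_le:
  fixes a :: "nat \<Rightarrow> real"
  assumes "a sums s"
  shows "ennreal \<bar>s\<bar> \<le> (\<Sum>i. ennreal \<bar>a i\<bar>)"
proof (rule LIMSEQ_le_const2)
  show "(\<lambda>n. ennreal \<bar>\<Sum>i<n. a i\<bar>) \<longlonglongrightarrow> ennreal \<bar>s\<bar>"
    using assms unfolding sums_def by (intro tendsto_ennrealI tendsto_rabs)
  have "ennreal \<bar>\<Sum>i<n. a i\<bar> \<le> (\<Sum>i. ennreal \<bar>a i\<bar>)" for n
  proof -
    have "ennreal \<bar>\<Sum>i<n. a i\<bar> \<le> ennreal (\<Sum>i<n. \<bar>a i\<bar>)" by (intro ennreal_leI sum_abs)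
    also have "\<dots> = (\<Sum>i<n. ennreal \<bar>a i\<bar>)" by (simp add: sum_ennreal)
    also have "\<dots> \<le> (\<Sum>i. ennreal \<bar>a i\<bar>)" by (rule sum_le_suminf) auto
    finally show ?thesis .
  qed
  then show "\<exists>N. \<forall>n\<ge>N. ennreal \<bar>\<Sum>i<n. a i\<bar> \<le> (\<Sum>i. ennreal \<bar>a i\<bar>)" by blast
qed

text \<open>For \<open>\<le>\<close>, finite superadditivity passes to the limit. For the converse
  each member of a competing family is cut along the \<open>A i\<close>, countable additivity of
  \<open>\<nu>\<close> bounds its value by those of the pieces, and the two sums are
  exchanged.\<close>

lemma var_on_countably_additive:
  assumes \<nu>: "finite_signed01 \<nu>" and A: "\<And>i::nat. A i \<in> borel01" and disj: "disjoint_family A"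
  shows "(\<Sum>i. var_on \<nu> (A i)) = var_on \<nu> (\<Union>i. A i)"
proof (rule antisym)
  note e = finite_signed01_empty[OF \<nu>]
  have "(\<Sum>i<n. var_on \<nu> (A i)) \<le> var_on \<nu> (\<Union>i<n. A i)" for n
  proof (induction n)
    case (Suc n)
    have "(\<Union>i<n. A i) \<inter> A n = {}" by (rule disjoint_family_lessThan[OF disj])
    from var_on_superadditive[of \<nu>, OF e this] Suc
    show ?case by (simp add: lessThan_Suc Un_commute add.commute) (meson add_left_mono order_trans)
  qed simp
  then have "(\<Sum>i<n. var_on \<nu> (A i)) \<le> var_on \<nu> (\<Union>i. A i)" for n
    by (rule order_trans) (auto intro!: var_on_mono)
  then show "(\<Sum>i. var_on \<nu> (A i)) \<le> var_on \<nu> (\<Union>i. A i)"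
    by (intro suminf_le_const) auto
  show "var_on \<nu> (\<Union>i. A i) \<le> (\<Sum>i. var_on \<nu> (A i))"
  proof (rule var_on_least)
    fix P assume P: "finite P" "P \<subseteq> borel01" "disjoint P" "\<Union>P \<subseteq> (\<Union>i. A i)"
    have "(\<Sum>B\<in>P. ennreal \<bar>\<nu> B\<bar>) \<le> (\<Sum>B\<in>P. \<Sum>i. ennreal \<bar>\<nu> (B \<inter> A i)\<bar>)"
    proof (intro sum_mono ennreal_abs_sums_le)
      fix B assume B: "B \<in> P"
      have "(\<lambda>i. \<nu> (B \<inter> A i)) sums \<nu> (\<Union>i. B \<inter> A i)"
        by (rule finite_signed01_sums[OF \<nu> _ disjoint_family_subset[OF disj]])
          (use A P B in \<open>auto intro!: borel01_Int borel01_sets\<close>)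
      also have "(\<Union>i. B \<inter> A i) = B" using P B by blast
      finally show "(\<lambda>i. \<nu> (B \<inter> A i)) sums \<nu> B" .
    qed
    also have "\<dots> = (\<Sum>i. \<Sum>B\<in>P. ennreal \<bar>\<nu> (B \<inter> A i)\<bar>)"
      by (rule suminf_sum[symmetric]) auto
    also have "\<dots> \<le> (\<Sum>i. var_on \<nu> (A i))"
    proof (rule suminf_le)
      fix i
      \<comment> \<open>\<open>B \<inter> A i\<close> can coincide for different \<open>B\<close>
        only when it is empty, so passing from the indexed sum to a sum over sets loses
        nothing.\<close>
      have "(\<Sum>B\<in>P. ennreal \<bar>\<nu> (B \<inter> A i)\<bar>) = (\<Sum>B\<in>(\<lambda>B. B \<inter> A i) ` P. ennreal \<bar>\<nu> B\<bar>)"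
      proof (subst sum.reindex_nontrivial)
        fix x y assume *: "x \<in> P" "y \<in> P" "x \<noteq> y" "x \<inter> A i = y \<inter> A i"
        then have "x \<inter> A i = {}" using P(3) by (auto simp: disjoint_def)
        then show "ennreal \<bar>\<nu> (x \<inter> A i)\<bar> = 0" by (simp add: e)
      qed (use P in auto)
      also have "\<dots> \<le> var_on \<nu> (A i)"
      proof (rule var_on_upper)
        show "disjoint ((\<lambda>B. B \<inter> A i) ` P)" using P(3) unfolding disjoint_def by blast
      qed (use P A in \<open>auto intro!: borel01_Int borel01_sets\<close>)
      finally show "(\<Sum>B\<in>P. ennreal \<bar>\<nu> (B \<inter> A i)\<bar>) \<le> var_on \<nu> (A i)" .
    qed auto
    finally show "(\<Sum>B\<in>P. ennreal \<bar>\<nu> B\<bar>) \<le> (\<Sum>i. var_on \<nu> (A i))" .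
  qed
qed

text \<open>Carried by the whole line and not by the unit interval, so that theorems on finite Borel
  measures on the line, such as \<open>inner_regular\<close> and \<open>outer_regular\<close>, apply
  to it.\<close>

definition var_measure :: "(real set \<Rightarrow> real) \<Rightarrow> real measure" where
  "var_measure \<nu> = measure_of UNIV (sets borel) (\<lambda>A. var_on \<nu> (A \<inter> {0..1}))"

lemma sets_var_measure [simp, measurable_cong]: "sets (var_measure \<nu>) = sets borel"
  and space_var_measure [simp]: "space (var_measure \<nu>) = UNIV"
  unfolding var_measure_def
  by (metis sets.sets_measure_of_eq space_borel, simp add: space_measure_of_conv)

lemma emeasure_var_measure:
  assumes \<nu>: "finite_signed01 \<nu>" and A: "A \<in> sets borel"
  shows "emeasure (var_measure \<nu>) A = var_on \<nu> (A \<inter> {0..1})"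
proof (rule emeasure_measure_of[OF var_measure_def])
  have "var_on \<nu> {} = 0"
    using finite_signed01_empty[OF \<nu>]
    by (intro antisym var_on_least) (auto intro!: sum.neutral simp: subset_singleton_iff)
  then show "positive (sets (var_measure \<nu>)) (\<lambda>A. var_on \<nu> (A \<inter> {0..1}))" by (simp add: positive_def)
  show "countably_additive (sets (var_measure \<nu>)) (\<lambda>A. var_on \<nu> (A \<inter> {0..1}))"
  proof (rule countably_additiveI)
    fix F :: "nat \<Rightarrow> real set" assume "range F \<subseteq> sets (var_measure \<nu>)" "disjoint_family F"
    then have "(\<Sum>i. var_on \<nu> (F i \<inter> {0..1})) = var_on \<nu> (\<Union>i. F i \<inter> {0..1})"
      by (intro var_on_countably_additive[OF \<nu>] borel01_Int_Icc) (auto elim: disjoint_family_subset)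
    then show "(\<Sum>i. var_on \<nu> (F i \<inter> {0..1})) = var_on \<nu> (\<Union> (range F) \<inter> {0..1})"
      by (simp add: Int_UN_distrib2)
  qed
qed (use A in auto)

lemma finite_var_measure: assumes "finite_signed01 \<nu>" shows "finite_measure (var_measure \<nu>)"
  using finite_signed01_tv[OF assms]
  by (intro finite_measureI) (simp add: emeasure_var_measure[OF assms] tv_norm_def)

lemma abs_le_var_measure:
  assumes "finite_signed01 \<nu>" "A \<in> borel01"
  shows "\<bar>\<nu> A\<bar> \<le> measure (var_measure \<nu>) A"
proof -
  interpret finite_measure "var_measure \<nu>" by (rule finite_var_measure[OF assms(1)])
  have "ennreal \<bar>\<nu> A\<bar> \<le> emeasure (var_measure \<nu>) A"
    using assms by (simp add: emeasure_var_measure borel01_sets abs_le_var_on borel01_subset)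
  then show ?thesis by (simp add: emeasure_eq_measure)
qed

text \<open>The variation is a finite Borel measure on the line, hence regular: inner and outer
  approximation within \<open>e / 2\<close> each leave a gap \<open>U - K\<close> of variation less
  than \<open>e\<close>.\<close>

lemma finite_signed01_regular:
  assumes \<nu>: "finite_signed01 \<nu>"
  shows "signed_measure01 \<nu>"
  unfolding signed_measure01_def
proof (intro conjI ballI allI impI)
  fix A and e :: real assume A: "A \<in> borel01" and e: "0 < e"
  let ?M = "var_measure \<nu>"
  interpret finite_measure ?M by (rule finite_var_measure[OF \<nu>])
  have A': "A \<in> sets borel" by (rule borel01_sets[OF A])
  have fin: "emeasure ?M (space ?M) \<noteq> \<infinity>" by simp
  have "emeasure ?M A < emeasure ?M A + ennreal (e / 2)"
    using e by (simp add: emeasure_eq_measure ennreal_less_iff flip: ennreal_plus)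
  then have "(INF U\<in>{U. A \<subseteq> U \<and> open U}. emeasure ?M U) < emeasure ?M A + ennreal (e / 2)"
    by (subst (asm) (1) outer_regular[OF _ fin A']) auto
  then obtain U where U: "A \<subseteq> U" "open U" "emeasure ?M U < emeasure ?M A + ennreal (e / 2)"
    unfolding INF_less_iff by blast
  have "emeasure ?M A < emeasure ?M A + ennreal (e / 2)"
    using e by (simp add: emeasure_eq_measure ennreal_less_iff flip: ennreal_plus)
  also have "\<dots> = (SUP K\<in>{K. K \<subseteq> A \<and> compact K}. emeasure ?M K + ennreal (e / 2))"
    by (subst inner_regular[OF _ fin A']) (auto intro!: ennreal_SUP_add_left[symmetric])
  finally obtain K where K: "K \<subseteq> A" "compact K" "emeasure ?M A < emeasure ?M K + ennreal (e / 2)"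
    unfolding less_SUP_iff by blast
  have meas [simp]: "U \<in> sets borel" "K \<in> sets borel" using U K by (auto simp: borel_compact)
  have "measure ?M U < measure ?M A + e / 2" "measure ?M A < measure ?M K + e / 2"
    using U(3) K(3) e by (simp_all add: emeasure_eq_measure ennreal_less_iff flip: ennreal_plus)
  moreover have "measure ?M (U - K) = measure ?M U - measure ?M K"
    using U K by (intro finite_measure_Diff) auto
  ultimately have "emeasure ?M (U - K) < ennreal e"
    using measure_nonneg[of ?M "U - K"] by (simp add: emeasure_eq_measure ennreal_less_iff)
  moreover have "(U - K) \<inter> {0..1} = U \<inter> {0..1} - K" by blast
  ultimately have "var_on \<nu> ((U \<inter> {0..1}) - K) < ennreal e"
    by (simp add: emeasure_var_measure[OF \<nu> sets.Diff[OF meas]])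
  then show "\<exists>K U. compact K \<and> K \<subseteq> A \<and> open U \<and> A \<subseteq> U \<and> var_on \<nu> ((U \<inter> {0..1}) - K) < ennreal e"
    using U K by blast
qed (use \<nu> in \<open>auto simp: finite_signed01_def\<close>)

lemma signed_measure01_iff: "signed_measure01 \<nu> \<longleftrightarrow> finite_signed01 \<nu>"
  using finite_signed01_regular signed_measure01_imp_finite_signed01 by blast

text \<open>Uniform distributions on cells, weak* limits and indefinite integrals are all recognised
  as signed measures in this way. The bound is \<open>|a - b| \<le> a + b\<close> summed over a
  disjoint family.\<close>

lemma finite_signed01_diff_measure:
  assumes M: "finite_measure M" "sets M = sets borel" and N: "finite_measure N" "sets N = sets borel"
  defines "\<nu> \<equiv> \<lambda>A. if A \<in> borel01 then measure M A - measure N A else 0"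
  shows "finite_signed01 \<nu>" "tv_norm \<nu> \<le> ennreal (measure M {0..1} + measure N {0..1})"
proof -
  interpret M: finite_measure M by fact
  interpret N: finite_measure N by fact
  show tv: "tv_norm \<nu> \<le> ennreal (measure M {0..1} + measure N {0..1})"
    unfolding tv_norm_def
  proof (rule var_on_least)
    fix P assume P: "finite P" "P \<subseteq> borel01" "disjoint P" "\<Union>P \<subseteq> {0..1::real}"
    have sets: "P \<subseteq> sets borel" using P by (auto simp: borel01_def)
    have "(\<Sum>B\<in>P. \<bar>\<nu> B\<bar>) \<le> (\<Sum>B\<in>P. measure M B + measure N B)"
      using P unfolding \<nu>_def by (intro sum_mono) (auto simp: abs_le_iff add_increasing add_increasing2)
    also have "\<dots> = measure M (\<Union>P) + measure N (\<Union>P)"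
      using P(1,3) sets
      using M.finite_measure_finite_Union[of P "\<lambda>x. x"] N.finite_measure_finite_Union[of P "\<lambda>x. x"]
      by (simp add: sum.distrib M N disjoint_family_on_def disjoint_def)
    also have "\<dots> \<le> measure M {0..1} + measure N {0..1}"
      using P(4) M N by (intro add_mono M.finite_measure_mono N.finite_measure_mono) auto
    finally show "(\<Sum>B\<in>P. ennreal \<bar>\<nu> B\<bar>) \<le> ennreal (measure M {0..1} + measure N {0..1})"
      by (simp add: ennreal_leI del: ennreal_plus)
  qed
  have "(\<lambda>n. \<nu> (F n)) sums \<nu> (\<Union>n. F n)" if F: "range F \<subseteq> borel01" "disjoint_family F" for F :: "nat \<Rightarrow> real set"
  proof -
    have "\<nu> (F n) = measure M (F n) - measure N (F n)" "\<nu> (\<Union>n. F n) = measure M (\<Union>n. F n) - measure N (\<Union>n. F n)" for n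
      using F borel01_UN[of F] by (auto simp: \<nu>_def)
    moreover have "range F \<subseteq> sets borel" using F by (auto simp: borel01_def)
    ultimately show ?thesis
      using F by (simp only:) (intro sums_diff M.finite_measure_UNION N.finite_measure_UNION; simp add: M N)
  qed
  then show "finite_signed01 \<nu>"
    unfolding finite_signed01_def
    using order_le_less_trans[OF tv, of top] by (auto simp: \<nu>_def)
qed

text \<open>The first measure of this Jordan-type decomposition is the full variation.\<close>

lemma finite_signed01_decomposition:
  assumes \<nu>: "finite_signed01 \<nu>"
  obtains N where "finite_measure N" "sets N = sets borel"
    "\<And>A. A \<in> borel01 \<Longrightarrow> \<nu> A = measure (var_measure \<nu>) A - measure N A"
    "\<And>A. A \<in> sets borel \<Longrightarrow> emeasure (var_measure \<nu>) A = 0 \<Longrightarrow> emeasure N A = 0"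
proof -
  let ?M = "var_measure \<nu>"
  interpret M: finite_measure ?M by (rule finite_var_measure[OF \<nu>])
  define h where "h A = measure ?M A - \<nu> (A \<inter> {0..1})" for A
  define N where "N = measure_of UNIV (sets borel) (\<lambda>A. ennreal (h A))"
  have abs: "\<bar>\<nu> (A \<inter> {0..1})\<bar> \<le> measure ?M A" if "A \<in> sets borel" for A
    using abs_le_var_measure[OF \<nu> borel01_Int_Icc[OF that]] M.finite_measure_mono[of "A \<inter> {0..1}" A] that
    by simp
  have h: "0 \<le> h A" if "A \<in> sets borel" for A using abs[OF that] by (simp add: h_def)
  have sets: "sets N = sets borel" unfolding N_def by (metis sets.sets_measure_of_eq space_borel)
  have N: "emeasure N A = ennreal (h A)" if "A \<in> sets borel" for A
  proof (rule emeasure_measure_of[OF N_def])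
    show "positive (sets N) (\<lambda>A. ennreal (h A))"
      by (simp add: positive_def h_def finite_signed01_empty[OF \<nu>])
    show "countably_additive (sets N) (\<lambda>A. ennreal (h A))"
    proof (rule countably_additiveI)
      fix F :: "nat \<Rightarrow> real set" assume F: "range F \<subseteq> sets N" "disjoint_family F"
      have "(\<lambda>i. h (F i)) sums (measure ?M (\<Union> (range F)) - \<nu> (\<Union>i. F i \<inter> {0..1}))"
        unfolding h_def using F sets
        by (intro sums_diff M.finite_measure_UNION finite_signed01_sums[OF \<nu>] borel01_Int_Icc)
          (auto elim: disjoint_family_subset)
      also have "\<dots> = h (\<Union> (range F))" by (simp add: h_def)
      finally show "(\<Sum>i. ennreal (h (F i))) = ennreal (h (\<Union> (range F)))"
        using F sets by (intro suminf_ennreal_eq h) auto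
    qed
  qed (use that sets in auto)
  have space: "space N = UNIV" using sets_eq_imp_space_eq[OF sets] by simp
  show thesis
  proof (rule that[OF _ sets])
    show "finite_measure N" by (rule finite_measureI) (simp add: space N)
    show "\<nu> A = measure ?M A - measure N A" if "A \<in> borel01" for A
    proof -
      have "A \<inter> {0..1} = A" using borel01_subset[OF that] by blast
      then show ?thesis
        using N[of A] h[of A] borel01_sets[OF that] by (simp add: measure_def h_def)
    qed
    show "emeasure N A = 0" if "A \<in> sets borel" "emeasure ?M A = 0" for A
      using abs[OF that(1)] that by (simp add: N h_def measure_def)
  qed
qed

text \<open>Dynkin's argument: the rays \<open>{..x}\<close> are stable under intersection and
  generate the Borel sets, and on the unit interval they cut out initial segments. That a measure is
  determined by its distribution function later pins down the weak* limit.\<close>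

lemma finite_signed01_eqI:
  assumes \<nu>: "finite_signed01 \<nu>" and \<mu>: "finite_signed01 \<mu>"
    and eq: "\<And>x. 0 \<le> x \<Longrightarrow> x \<le> 1 \<Longrightarrow> \<nu> {0..x} = \<mu> {0..x}"
  shows "\<nu> = \<mu>"
proof
  fix A
  show "\<nu> A = \<mu> A"
  proof (cases "A \<in> borel01")
    case True
    have gen: "sets borel = sigma_sets UNIV (range (atMost :: real \<Rightarrow> _))"
      by (simp add: borel_eq_atMost)
    have int: "Int_stable (range (atMost :: real \<Rightarrow> _))"
      by (auto simp: Int_stable_def)
    have cl: "range (atMost :: real \<Rightarrow> _) \<subseteq> Pow UNIV" by simp
    have "\<nu> (B \<inter> {0..1}) = \<mu> (B \<inter> {0..1})" if "B \<in> sigma_sets UNIV (range (atMost :: real \<Rightarrow> _))" for B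
      using int cl that
    proof (induction rule: sigma_sets_induct_disjoint)
      case (basic B)
      then obtain x where x: "B = {..x}" by auto
      show ?case
      proof (cases "x < 0")
        case True
        then have "B \<inter> {0..1} = {}" by (auto simp: x)
        then show ?thesis by (simp add: finite_signed01_empty[OF \<nu>] finite_signed01_empty[OF \<mu>])
      next
        case False
        then have "B \<inter> {0..1} = {0..min x 1}" by (auto simp: x)
        then show ?thesis using False by (simp add: eq)
      qed
    next
      case empty
      show ?case by (simp add: finite_signed01_empty[OF \<nu>] finite_signed01_empty[OF \<mu>])
    next
      \<comment> \<open>Complements require equal total masses, which is the case
        \<open>x = 1\<close> of the hypothesis.\<close>
      case (compl B)
      then have B: "B \<inter> {0..1} \<in> borel01" by (intro borel01_Int_Icc) (simp add: gen)
      have "(UNIV - B) \<inter> {0..1} = {0..1} - B \<inter> {0..1}" by blast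
      then show ?case
        using compl(2) eq[of 1]
        by (simp add: finite_signed01_Diff[OF \<nu> borel01_Icc B] finite_signed01_Diff[OF \<mu> borel01_Icc B])
    next
      case (union F)
      have F: "F i \<inter> {0..1} \<in> borel01" for i using union(2) by (intro borel01_Int_Icc) (auto simp: gen)
      have d: "disjoint_family (\<lambda>i. F i \<inter> {0..1})" using union(1) by (rule disjoint_family_subset) auto
      have "(\<Union>i. F i \<inter> {0..1}) = (\<Union>i. F i) \<inter> {0..1}" by blast
      then show ?case
        using finite_signed01_sums[OF \<nu> F d] finite_signed01_sums[OF \<mu> F d] union(3)
        by (simp add: sums_unique2)
    qed
    then have "\<nu> (A \<inter> {0..1}) = \<mu> (A \<inter> {0..1})" using borel01_sets[OF True] gen by blast
    then show ?thesis using borel01_subset[OF True] by (simp add: Int_absorb2)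
  qed (simp add: finite_signed01_outside[OF \<nu>] finite_signed01_outside[OF \<mu>])
qed

section \<open>The normed spaces of all measures and of the absolutely continuous ones\<close>

lemma finite_signed01_add:
  assumes "finite_signed01 \<nu>" "finite_signed01 \<mu>"
  shows "finite_signed01 (\<nu> + \<mu>)" "tv_norm (\<nu> + \<mu>) \<le> tv_norm \<nu> + tv_norm \<mu>"
proof -
  show tv: "tv_norm (\<nu> + \<mu>) \<le> tv_norm \<nu> + tv_norm \<mu>"
    unfolding tv_norm_def
  proof (rule var_on_least)
    fix P assume P: "finite P" "P \<subseteq> borel01" "disjoint P" "\<Union>P \<subseteq> {0..1::real}"
    have "(\<Sum>B\<in>P. ennreal \<bar>(\<nu> + \<mu>) B\<bar>) \<le> (\<Sum>B\<in>P. ennreal \<bar>\<nu> B\<bar> + ennreal \<bar>\<mu> B\<bar>)"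
      by (intro sum_mono) (simp add: ennreal_leI flip: ennreal_plus)
    also have "\<dots> \<le> var_on \<nu> {0..1} + var_on \<mu> {0..1}"
      unfolding sum.distrib by (intro add_mono var_on_upper P)
    finally show "(\<Sum>B\<in>P. ennreal \<bar>(\<nu> + \<mu>) B\<bar>) \<le> var_on \<nu> {0..1} + var_on \<mu> {0..1}" .
  qed
  have "tv_norm (\<nu> + \<mu>) < \<infinity>"
    by (rule order_le_less_trans[OF tv]) (use assms in \<open>simp add: finite_signed01_def\<close>)
  then show "finite_signed01 (\<nu> + \<mu>)"
    using assms by (auto simp: finite_signed01_def intro: sums_add)
qed

lemma finite_signed01_scaleR:
  assumes "finite_signed01 \<nu>"
  shows "finite_signed01 (a *\<^sub>R \<nu>)" "tv_norm (a *\<^sub>R \<nu>) \<le> ennreal \<bar>a\<bar> * tv_norm \<nu>"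
proof -
  show tv: "tv_norm (a *\<^sub>R \<nu>) \<le> ennreal \<bar>a\<bar> * tv_norm \<nu>"
    unfolding tv_norm_def
  proof (rule var_on_least)
    fix P assume P: "finite P" "P \<subseteq> borel01" "disjoint P" "\<Union>P \<subseteq> {0..1::real}"
    have "(\<Sum>B\<in>P. ennreal \<bar>(a *\<^sub>R \<nu>) B\<bar>) = ennreal \<bar>a\<bar> * (\<Sum>B\<in>P. ennreal \<bar>\<nu> B\<bar>)"
      by (simp add: sum_distrib_left abs_mult sum_nonneg flip: ennreal_mult)
    also have "\<dots> \<le> ennreal \<bar>a\<bar> * var_on \<nu> {0..1}"
      by (intro mult_left_mono var_on_upper P) simp
    finally show "(\<Sum>B\<in>P. ennreal \<bar>(a *\<^sub>R \<nu>) B\<bar>) \<le> ennreal \<bar>a\<bar> * var_on \<nu> {0..1}" .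
  qed
  have "tv_norm (a *\<^sub>R \<nu>) < \<infinity>"
    by (rule order_le_less_trans[OF tv]) (use assms in \<open>simp add: finite_signed01_def ennreal_mult_less_top\<close>)
  then show "finite_signed01 (a *\<^sub>R \<nu>)"
    using assms by (auto simp: finite_signed01_def intro: sums_mult)
qed

text \<open>\<open>tv_norm\<close> alone can be finite for set functions that are not countably
  additive; the value \<open>\<infinity>\<close> removes them.\<close>

definition M_norm :: "(real set \<Rightarrow> real) \<Rightarrow> ennreal" where
  "M_norm \<nu> = (if finite_signed01 \<nu> then tv_norm \<nu> else \<infinity>)"

text \<open>Absolute continuity with respect to Lebesgue measure.\<close>

definition null_on_null :: "(real set \<Rightarrow> real) \<Rightarrow> bool" where
  "null_on_null \<nu> \<longleftrightarrow> (\<forall>A\<in>borel01. emeasure lborel A = 0 \<longrightarrow> \<nu> A = 0)"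

text \<open>By Radon-Nikodym this is \<open>L_1[0,1]\<close> with its norm, each class of functions
  being replaced by its indefinite integral.\<close>

definition ac_norm :: "(real set \<Rightarrow> real) \<Rightarrow> ennreal" where
  "ac_norm \<nu> = (if finite_signed01 \<nu> \<and> null_on_null \<nu> then tv_norm \<nu> else \<infinity>)"

lemma M_norm_finite_iff: "M_norm \<nu> < \<infinity> \<longleftrightarrow> finite_signed01 \<nu>"
  by (auto simp: M_norm_def finite_signed01_def)

lemma ac_norm_finite_iff: "ac_norm \<nu> < \<infinity> \<longleftrightarrow> finite_signed01 \<nu> \<and> null_on_null \<nu>"
  by (auto simp: ac_norm_def finite_signed01_def)

lemma tv_norm_zero: "tv_norm 0 = 0"
  unfolding tv_norm_def by (intro antisym var_on_least) auto

lemma finite_signed01_zero: "finite_signed01 0"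
  by (simp add: finite_signed01_def tv_norm_zero)

lemma ext_norm_M_norm: "ext_norm M_norm"
  unfolding ext_norm_def
proof (intro conjI allI)
  show "M_norm (x + y) \<le> M_norm x + M_norm y" for x y
    by (auto simp: M_norm_def finite_signed01_add)
  \<comment> \<open>For \<open>a = 0\<close> the right-hand side is 0 even if
    \<open>M_norm x\<close> is infinite, so the left-hand side has to be computed as the norm of the
    zero measure.\<close>
  show "M_norm (a *\<^sub>R x) \<le> ennreal \<bar>a\<bar> * M_norm x" for a x
    by (cases "a = 0")
      (auto simp: M_norm_def finite_signed01_scaleR ennreal_mult_top tv_norm_zero finite_signed01_zero)
qed

lemma ext_norm_ac_norm: "ext_norm ac_norm"
  unfolding ext_norm_def
proof (intro conjI allI)
  show "ac_norm (x + y) \<le> ac_norm x + ac_norm y" for x y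
    by (auto simp: ac_norm_def finite_signed01_add null_on_null_def)
  show "ac_norm (a *\<^sub>R x) \<le> ennreal \<bar>a\<bar> * ac_norm x" for a x
    by (cases "a = 0")
      (auto simp: ac_norm_def finite_signed01_scaleR ennreal_mult_top tv_norm_zero finite_signed01_zero
        null_on_null_def)
qed

lemma linf_M01_iff: "\<mu> \<in> linf_M01 \<longleftrightarrow> linf M_norm \<mu> < \<infinity>"
  and linf_norm_eq: "\<mu> \<in> linf_M01 \<Longrightarrow> linf_norm \<mu> = linf M_norm \<mu>"
proof -
  have *: "linf_norm \<mu> = linf M_norm \<mu>" if "\<And>k. finite_signed01 (\<mu> k)"
    using that by (simp add: linf_norm_def linf_def M_norm_def)
  then show "\<mu> \<in> linf_M01 \<Longrightarrow> linf_norm \<mu> = linf M_norm \<mu>"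
    by (simp add: linf_M01_def signed_measure01_iff)
  have "finite_signed01 (\<mu> k)" if "linf M_norm \<mu> < \<infinity>" for k
    using linf_nth_finite[OF that] M_norm_finite_iff by blast
  then show "\<mu> \<in> linf_M01 \<longleftrightarrow> linf M_norm \<mu> < \<infinity>"
    using * by (auto simp: linf_M01_def signed_measure01_iff)
qed

section \<open>The absolutely continuous part\<close>

text \<open>Exhaustion: the union of null sets whose variations approach the supremum over all null
  sets attains that supremum. A further disjoint null set of positive variation would exceed it,
  since the variation is superadditive and finite.\<close>

lemma maximal_null_set:
  assumes \<nu>: "finite_signed01 \<nu>"
  obtains Z where "Z \<in> borel01" "emeasure lborel Z = 0"
    "\<And>A. A \<in> borel01 \<Longrightarrow> emeasure lborel A = 0 \<Longrightarrow> A \<inter> Z = {} \<Longrightarrow> \<nu> A = 0"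
proof -
  let ?N = "{Z \<in> borel01. emeasure lborel Z = 0}"
  have "?N \<noteq> {}" by (auto intro!: exI[of _ "{}"])
  from ennreal_SUP_countable_SUP[OF this, of "var_on \<nu>"]
  obtain f :: "nat \<Rightarrow> ennreal" where f: "range f \<subseteq> var_on \<nu> ` ?N" "(SUP Z\<in>?N. var_on \<nu> Z) = Sup (range f)" by blast
  have "\<forall>i. \<exists>Z\<in>?N. f i = var_on \<nu> Z" using f(1) by blast
  then obtain Zs where Zs: "\<And>i. Zs i \<in> ?N" "\<And>i. f i = var_on \<nu> (Zs i)" by metis
  define Z where "Z = (\<Union>i::nat. Zs i)"
  have Z: "Z \<in> borel01" unfolding Z_def using Zs(1) by (intro borel01_UN) auto
  have Z0: "emeasure lborel Z = 0" unfolding Z_def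
    by (rule emeasure_UN_eq_0) (use Zs(1) in \<open>auto simp: borel01_def\<close>)
  have sup: "(SUP Z\<in>?N. var_on \<nu> Z) \<le> var_on \<nu> Z"
    unfolding f(2) by (rule Sup_least) (auto simp: Zs(2) Z_def intro!: var_on_mono)
  show thesis
  proof (rule that[OF Z Z0])
    fix A assume A: "A \<in> borel01" "emeasure lborel A = 0" "A \<inter> Z = {}"
    have "emeasure lborel (A \<union> Z) = 0"
      using emeasure_Un_null_set[of A lborel Z] A Z Z0 by (auto simp: borel01_def null_sets_def)
    then have "var_on \<nu> (A \<union> Z) \<le> (SUP Z\<in>?N. var_on \<nu> Z)"
      using A Z by (intro SUP_upper) (auto simp: borel01_Un)
    then have "var_on \<nu> A + var_on \<nu> Z \<le> var_on \<nu> Z"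
      using var_on_superadditive[of \<nu> A Z, OF finite_signed01_empty[OF \<nu>] A(3)] sup by order
    moreover have "var_on \<nu> Z < top"
      using var_on_mono[OF borel01_subset[OF Z], of \<nu>] finite_signed01_tv[OF \<nu>]
      by (simp add: tv_norm_def order_le_less_trans)
    ultimately have "var_on \<nu> A = 0"
      using ennreal_add_left_cancel_le[of "var_on \<nu> Z" "var_on \<nu> A" 0] by (auto simp: add.commute)
    then show "\<nu> A = 0" using abs_le_var_on[OF A(1) order_refl, of \<nu>] by simp
  qed
qed

text \<open>Such a set is unique only up to sets of variation 0, so the choice need not be
  compatible with sums; \<open>ac_part_eq\<close> repairs this.\<close>

definition carrier_null :: "(real set \<Rightarrow> real) \<Rightarrow> real set" where
  "carrier_null \<nu> = (SOME Z. Z \<in> borel01 \<and> emeasure lborel Z = 0 \<and>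
     (\<forall>A\<in>borel01. emeasure lborel A = 0 \<longrightarrow> A \<inter> Z = {} \<longrightarrow> \<nu> A = 0))"

lemma carrier_null:
  assumes "finite_signed01 \<nu>"
  shows "carrier_null \<nu> \<in> borel01" "emeasure lborel (carrier_null \<nu>) = 0"
    "\<And>A. A \<in> borel01 \<Longrightarrow> emeasure lborel A = 0 \<Longrightarrow> A \<inter> carrier_null \<nu> = {} \<Longrightarrow> \<nu> A = 0"
proof -
  have "\<exists>Z. Z \<in> borel01 \<and> emeasure lborel Z = 0 \<and>
     (\<forall>A\<in>borel01. emeasure lborel A = 0 \<longrightarrow> A \<inter> Z = {} \<longrightarrow> \<nu> A = 0)"
    by (rule maximal_null_set[OF assms]) blast
  from someI_ex[OF this] show "carrier_null \<nu> \<in> borel01" "emeasure lborel (carrier_null \<nu>) = 0"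
    "\<And>A. A \<in> borel01 \<Longrightarrow> emeasure lborel A = 0 \<Longrightarrow> A \<inter> carrier_null \<nu> = {} \<Longrightarrow> \<nu> A = 0"
    unfolding carrier_null_def by blast+
qed

text \<open>The absolutely continuous part in the Lebesgue decomposition; the singular part is the
  restriction of \<open>\<nu>\<close> to \<open>carrier_null \<nu>\<close>.\<close>

definition ac_part :: "(real set \<Rightarrow> real) \<Rightarrow> real set \<Rightarrow> real" where
  "ac_part \<nu> A = (if A \<in> borel01 then \<nu> (A - carrier_null \<nu>) else 0)"

lemma emeasure_lborel_null_subset: "A \<in> borel01 \<Longrightarrow> A \<subseteq> Z \<Longrightarrow> Z \<in> borel01 \<Longrightarrow> emeasure lborel Z = 0 \<Longrightarrow> emeasure lborel A = 0"
  using emeasure_mono[of A Z lborel] by (auto simp: borel01_def)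

text \<open>What \<open>Z\<close> removes beyond the carrier is null and disjoint from it, so
  \<open>\<nu>\<close> vanishes there. One \<open>Z\<close> can therefore serve several measures at
  once, which yields the linearity of \<open>ac_part\<close>.\<close>

lemma ac_part_eq:
  assumes \<nu>: "finite_signed01 \<nu>" and Z: "Z \<in> borel01" "emeasure lborel Z = 0" "carrier_null \<nu> \<subseteq> Z"
    and A: "A \<in> borel01"
  shows "ac_part \<nu> A = \<nu> (A - Z)"
proof -
  note c = carrier_null[OF \<nu>]
  note [simp] = borel01_sets[OF c(1)] borel01_sets[OF Z(1)]
  have 1: "A - Z \<in> borel01" "A \<inter> Z - carrier_null \<nu> \<in> borel01"
    using A by (auto intro!: borel01_Diff borel01_Int)
  have "A - carrier_null \<nu> = (A - Z) \<union> (A \<inter> Z - carrier_null \<nu>)" using Z(3) by blast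
  moreover have "\<nu> (A \<inter> Z - carrier_null \<nu>) = 0"
    by (rule c(3)[OF 1(2)]) (auto intro!: emeasure_lborel_null_subset[OF 1(2) _ Z(1,2)])
  ultimately show ?thesis
    using finite_signed01_Un[OF \<nu> 1] A by (auto simp: ac_part_def)
qed

lemma ac_part:
  assumes \<nu>: "finite_signed01 \<nu>"
  shows "finite_signed01 (ac_part \<nu>)" "null_on_null (ac_part \<nu>)" "tv_norm (ac_part \<nu>) \<le> tv_norm \<nu>"
proof -
  note c = carrier_null[OF \<nu>]
  note [simp] = borel01_sets[OF c(1)]
  show tv: "tv_norm (ac_part \<nu>) \<le> tv_norm \<nu>"
    unfolding tv_norm_def[of "ac_part \<nu>"]
  proof (rule var_on_least)
    fix P assume P: "finite P" "P \<subseteq> borel01" "disjoint P" "\<Union>P \<subseteq> {0..1::real}"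
    have "(\<Sum>B\<in>P. ennreal \<bar>ac_part \<nu> B\<bar>) = ennreal (\<Sum>B\<in>P. \<bar>\<nu> (B - carrier_null \<nu>)\<bar>)"
      using P by (auto simp: ac_part_def intro!: arg_cong[where f = ennreal] sum.cong)
    also have "\<dots> \<le> tv_norm \<nu>"
    proof (rule sum_abs_le_tv)
      show "disjoint_family_on (\<lambda>B. B - carrier_null \<nu>) P"
        using P(3) unfolding disjoint_def disjoint_family_on_def by blast
    qed (use P finite_signed01_empty[OF \<nu>] in \<open>auto intro!: borel01_Diff\<close>)
    finally show "(\<Sum>B\<in>P. ennreal \<bar>ac_part \<nu> B\<bar>) \<le> tv_norm \<nu>" .
  qed
  have "(\<lambda>n. ac_part \<nu> (F n)) sums ac_part \<nu> (\<Union>n. F n)"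
    if F: "range F \<subseteq> borel01" "disjoint_family F" for F :: "nat \<Rightarrow> real set"
  proof -
    have "(\<lambda>n. \<nu> (F n - carrier_null \<nu>)) sums \<nu> (\<Union>n. F n - carrier_null \<nu>)"
      using F(1) by (intro finite_signed01_sums[OF \<nu> _ disjoint_family_subset[OF F(2)]] borel01_Diff) auto
    moreover have "(\<Union>n. F n - carrier_null \<nu>) = (\<Union>n. F n) - carrier_null \<nu>" by blast
    moreover have "F n \<in> borel01" "(\<Union>n. F n) \<in> borel01" for n using F(1) by (auto intro!: borel01_UN)
    ultimately show ?thesis by (simp add: ac_part_def)
  qed
  then show "finite_signed01 (ac_part \<nu>)"
    using order_le_less_trans[OF tv finite_signed01_tv[OF \<nu>]] by (auto simp: finite_signed01_def ac_part_def)
  show "null_on_null (ac_part \<nu>)"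
    unfolding null_on_null_def
  proof (intro ballI impI)
    fix A assume A: "A \<in> borel01" "emeasure lborel A = 0"
    have B: "A - carrier_null \<nu> \<in> borel01" by (rule borel01_Diff[OF A(1)]) simp
    have "\<nu> (A - carrier_null \<nu>) = 0"
      by (rule c(3)[OF B emeasure_lborel_null_subset[OF B Diff_subset A]]) blast
    then show "ac_part \<nu> A = 0" by (simp add: ac_part_def)
  qed
qed

lemma complemented_ac_M: "complemented ac_norm M_norm"
  unfolding complemented_def
proof (intro exI conjI allI impI)
  show "bounded_op ac_norm M_norm (\<lambda>x. x)"
    by (rule bounded_opI[where C = 1]) (auto simp: M_norm_def ac_norm_def)
  show "bounded_op M_norm ac_norm ac_part"
  proof (rule bounded_opI[where C = 1])
    fix x y assume "M_norm x < \<infinity>" "M_norm y < \<infinity>"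
    then have xy: "finite_signed01 x" "finite_signed01 y" by (simp_all only: M_norm_finite_iff)
    then have s: "finite_signed01 (x + y)" by (rule finite_signed01_add)
    \<comment> \<open>With a common null set all three parts are restrictions to the same
      complement, where additivity is immediate.\<close>
    define Z where "Z = carrier_null x \<union> carrier_null y \<union> carrier_null (x + y)"
    have Z: "Z \<in> borel01" unfolding Z_def by (intro borel01_Un carrier_null xy s)
    have "Z \<in> null_sets lborel" unfolding Z_def
      by (intro null_sets.Un) (use carrier_null[OF xy(1)] carrier_null[OF xy(2)] carrier_null[OF s] in \<open>auto simp: null_sets_def borel01_def\<close>)
    then have Z0: "emeasure lborel Z = 0" by auto
    have sub: "carrier_null x \<subseteq> Z" "carrier_null y \<subseteq> Z" "carrier_null (x + y) \<subseteq> Z"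
      unfolding Z_def by blast+
    have "ac_part (x + y) A = ac_part x A + ac_part y A" for A
    proof (cases "A \<in> borel01")
      case True
      show ?thesis
        by (simp add: ac_part_eq[OF xy(1) Z Z0 sub(1) True] ac_part_eq[OF xy(2) Z Z0 sub(2) True]
            ac_part_eq[OF s Z Z0 sub(3) True])
    qed (simp add: ac_part_def)
    then show "ac_part (x + y) = ac_part x + ac_part y" by (simp add: fun_eq_iff)
  next
    fix a x assume "M_norm x < \<infinity>"
    then have x: "finite_signed01 x" by (simp_all only: M_norm_finite_iff)
    then have s: "finite_signed01 (a *\<^sub>R x)" by (rule finite_signed01_scaleR)
    define Z where "Z = carrier_null x \<union> carrier_null (a *\<^sub>R x)"
    have Z: "Z \<in> borel01" unfolding Z_def by (intro borel01_Un carrier_null x s)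
    have "Z \<in> null_sets lborel" unfolding Z_def
      by (intro null_sets.Un) (use carrier_null[OF x(1)] carrier_null[OF s] in \<open>auto simp: null_sets_def borel01_def\<close>)
    then have Z0: "emeasure lborel Z = 0" by auto
    have sub: "carrier_null x \<subseteq> Z" "carrier_null (a *\<^sub>R x) \<subseteq> Z"
      unfolding Z_def by blast+
    have "ac_part (a *\<^sub>R x) A = a * ac_part x A" for A
    proof (cases "A \<in> borel01")
      case True
      show ?thesis
        by (simp add: ac_part_eq[OF x Z Z0 sub(1) True] ac_part_eq[OF s Z Z0 sub(2) True])
    qed (simp add: ac_part_def)
    then show "ac_part (a *\<^sub>R x) = a *\<^sub>R ac_part x" by (simp add: fun_eq_iff)
  next
    fix x assume "M_norm x < \<infinity>"
    then show "ac_norm (ac_part x) \<le> ennreal 1 * M_norm x"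
      by (simp add: ac_norm_def M_norm_def ac_part split: if_splits)
  qed simp
next
  fix y assume "ac_norm y < \<infinity>"
  then have y: "finite_signed01 y" "null_on_null y" by (simp_all only: ac_norm_finite_iff)
  note c = carrier_null[OF y(1)]
  show "ac_part y = y"
  proof
    fix A
    show "ac_part y A = y A"
    proof (cases "A \<in> borel01")
      case True
      have "A \<inter> carrier_null y \<in> borel01" using True c(1) by (intro borel01_Int) (auto simp: borel01_def)
      moreover from this have "y (A \<inter> carrier_null y) = 0"
        using y(2) c emeasure_lborel_null_subset[of "A \<inter> carrier_null y" "carrier_null y"]
        by (auto simp: null_on_null_def)
      moreover have "A - carrier_null y = A - A \<inter> carrier_null y" by blast
      ultimately show ?thesis
        using finite_signed01_Diff[OF y(1) True, of "A \<inter> carrier_null y"] True by (simp add: ac_part_def)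
    qed (simp add: ac_part_def finite_signed01_outside[OF y(1)])
  qed
qed

section \<open>Ultralimits and averages over partitions\<close>

text \<open>A free ultrafilter is a minimal proper filter below \<open>sequentially\<close>, since
  finer filters are smaller in this order. The infimum of a nonempty chain stays proper because
  whatever holds eventually for it already holds eventually for one member.\<close>

lemma ex_ultrafilter:
  "\<exists>U::nat filter. U \<noteq> bot \<and> U \<le> sequentially \<and> (\<forall>P. eventually P U \<or> eventually (\<lambda>x. \<not> P x) U)"
proof -
  let ?A = "{F::nat filter. F \<noteq> bot \<and> F \<le> sequentially}"
  have "\<exists>m\<in>?A. \<forall>a\<in>?A. m \<ge> a \<longrightarrow> a = m"
  proof (rule predicate_Zorn)
    show "partial_order_on ?A (relation_of (\<ge>) ?A)"
      by (rule partial_order_on_relation_ofI) auto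
  next
    fix C assume C: "C \<in> Chains (relation_of (\<ge>) ?A)"
    then have sub: "C \<subseteq> ?A" and tot: "\<And>F G. F \<in> C \<Longrightarrow> G \<in> C \<Longrightarrow> F \<le> G \<or> G \<le> F"
      by (auto simp: Chains_def relation_of_def)
    show "\<exists>u\<in>?A. \<forall>a\<in>C. u \<le> a"
    proof (cases "C = {}")
      case True
      then show ?thesis by (auto intro!: exI[of _ sequentially])
    next
      case False
      have "eventually P (Inf C) \<longleftrightarrow> (\<exists>b\<in>C. eventually P b)" for P
        by (rule eventually_Inf_base[OF False]) (metis tot inf.absorb1 inf.absorb2 order_refl)
      then have "Inf C \<noteq> bot" using sub by (auto simp: trivial_limit_def)
      moreover obtain F where "F \<in> C" using False by blast
      then have "Inf C \<le> sequentially" using sub by (intro Inf_lower2[of F]) auto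
      ultimately show ?thesis by (intro bexI[of _ "Inf C"]) (simp_all add: Inf_lower)
    qed
  qed
  then obtain U where U: "U \<noteq> bot" "U \<le> sequentially"
    and min: "\<And>F. F \<noteq> bot \<Longrightarrow> F \<le> sequentially \<Longrightarrow> F \<le> U \<Longrightarrow> F = U" by blast
  have "eventually P U \<or> eventually (\<lambda>x. \<not> P x) U" for P
  proof (rule ccontr)
    assume *: "\<not> ?thesis"
    \<comment> \<open>If neither \<open>P\<close> nor its negation holds eventually, adjoining
      \<open>P\<close> to \<open>U\<close> gives a proper filter, which minimality forces to be
      \<open>U\<close> itself.\<close>
    let ?F = "inf U (principal {x. P x})"
    have "?F \<noteq> bot" using * by (simp add: trivial_limit_def eventually_inf_principal)
    moreover have "?F \<le> sequentially" using U(2) by (simp add: le_infI1)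
    ultimately have "?F = U" by (intro min) auto
    moreover have "eventually P ?F" by (simp add: eventually_inf_principal)
    ultimately have "eventually P U" by simp
    with * show False by blast
  qed
  with U show ?thesis by blast
qed

text \<open>The image of the ultrafilter under a bounded sequence has a cluster point by
  compactness, and an ultrafilter converges to each of its cluster points. A single filter for all
  sequences is what makes the limit linear.\<close>

lemma ex_ultralimit:
  "\<exists>U::nat filter. U \<noteq> bot \<and> U \<le> sequentially \<and>
     (\<forall>f::nat \<Rightarrow> real. (\<exists>C. \<forall>n. \<bar>f n\<bar> \<le> C) \<longrightarrow> (\<exists>l. (f \<longlongrightarrow> l) U))"
proof -
  obtain U :: "nat filter" where U: "U \<noteq> bot" "U \<le> sequentially"
    and ultra: "\<And>P. eventually P U \<or> eventually (\<lambda>x. \<not> P x) U" using ex_ultrafilter by blast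
  have "\<exists>l. (f \<longlongrightarrow> l) U" if C: "\<And>n. \<bar>f n\<bar> \<le> C" for f :: "nat \<Rightarrow> real" and C
  proof -
    have "eventually (\<lambda>x. x \<in> {-C..C}) (filtermap f U)"
      using C by (simp add: eventually_filtermap abs_le_iff minus_le_iff)
    moreover have "filtermap f U \<noteq> bot" using U(1) by (simp add: filtermap_bot_iff)
    ultimately obtain l where l: "inf (nhds l) (filtermap f U) \<noteq> bot"
      using compact_Icc[of "-C" C] unfolding compact_filter by blast
    have "(f \<longlongrightarrow> l) U"
    proof (rule topological_tendstoI, rule ccontr)
      fix S assume S: "open S" "l \<in> S" "\<not> eventually (\<lambda>x. f x \<in> S) U"
      then have "eventually (\<lambda>x. f x \<notin> S) U" using ultra[of "\<lambda>x. f x \<in> S"] by blast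
      then have "eventually (\<lambda>y. y \<notin> S) (filtermap f U)" by (simp add: eventually_filtermap)
      moreover have "eventually (\<lambda>y. y \<in> S) (nhds l)" using S by (metis eventually_nhds)
      ultimately have "eventually (\<lambda>y. False) (inf (nhds l) (filtermap f U))"
        unfolding eventually_inf by blast
      then show False using l by (simp add: trivial_limit_def)
    qed
    then show ?thesis ..
  qed
  with U show ?thesis by blast
qed

text \<open>\<open>G\<close> need not be right-continuous, so its right limits \<open>H\<close> are
  taken as the distribution function, as in Helly's selection theorem. The mass is
  \<open>H 1\<close>, which is at most \<open>G 2\<close> and thus at most \<open>C\<close>.\<close>

lemma monotone_limit_measure:
  fixes G :: "real \<Rightarrow> real"
  assumes mono: "\<And>p q. p \<le> q \<Longrightarrow> G p \<le> G q" and pos: "\<And>q. 0 \<le> G q" and le: "\<And>q. G q \<le> C"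
    and neg: "\<And>q. q < 0 \<Longrightarrow> G q = 0"
  obtains M where "finite_measure M" "sets M = sets borel" "measure M {0..1} \<le> C"
    "\<And>x. 0 \<le> x \<Longrightarrow> x \<le> 1 \<Longrightarrow> (G \<longlongrightarrow> measure M {0..x}) (at_right x)"
proof -
  define H where "H x = Inf (G ` {x<..})" for x
  have bdd: "bdd_below (G ` S)" for S using pos by (auto simp: bdd_below_def)
  have H_le: "H x \<le> G q" if "x < q" for x q
    unfolding H_def using that by (intro cInf_lower bdd) auto
  have le_H: "c \<le> H x" if "\<And>q. x < q \<Longrightarrow> c \<le> G q" for c x
    unfolding H_def using that gt_ex[of x] by (intro cInf_greatest) auto
  have H_mono: "H x \<le> H y" if "x \<le> y" for x y
    by (rule le_H) (use that in \<open>auto intro: H_le\<close>)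
  have lim: "(G \<longlongrightarrow> H x) (at_right x)" for x
    using Lim_right_bound[of UNIV x G 0] mono pos by (simp add: H_def)
  have cont: "continuous (at_right a) H" for a
    unfolding continuous_within
  proof (rule order_tendstoI)
    fix b assume b: "b < H a"
    show "\<forall>\<^sub>F x in at_right a. b < H x"
      by (rule eventually_at_right_less[THEN eventually_mono]) (use b H_mono in \<open>force intro: less_le_trans\<close>)
  next
    fix b assume b: "H a < b"
    then have "\<forall>\<^sub>F q in at_right a. G q < b" using lim order_tendstoD(2) by blast
    then obtain q where q: "a < q" "\<And>y. a < y \<Longrightarrow> y < q \<Longrightarrow> G y < b"
      unfolding eventually_at_right_field by blast
    have "H x < b" if x: "a < x" "x < q" for x
    proof -
      obtain y where "x < y" "y < q" using dense x by blast
      then show ?thesis using H_le[of x y] q(2)[of y] x by simp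
    qed
    then show "\<forall>\<^sub>F x in at_right a. H x < b"
      unfolding eventually_at_right_field using q(1) by blast
  qed
  have H_neg: "H x = 0" if "x < 0" for x
  proof (rule antisym)
    show "H x \<le> 0" using H_le[of x "x / 2"] neg[of "x/2"] that by simp
    show "0 \<le> H x" by (rule le_H) (rule pos)
  qed
  let ?I = "interval_measure H"
  \<comment> \<open>Starting at -1 and not at 0 keeps the atom at 0: \<open>H\<close> vanishes on
    the negative numbers and may jump at 0.\<close>
  define M where "M = density ?I (indicator {-1<..1})"
  have Ioc: "emeasure ?I {a<..b} = ennreal (H b - H a)" if "a \<le> b" for a b
    using that by (intro emeasure_interval_measure_Ioc H_mono cont)
  have M: "emeasure M A = emeasure ?I (A \<inter> {-1<..1})" if "A \<in> sets borel" for A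
    unfolding M_def using that by (subst emeasure_density) (auto simp flip: indicator_inter_arith intro!: arg_cong[where f="emeasure ?I"])
  \<comment> \<open>\<open>H\<close> is 0 at both ends of each interval of the union, so the part of
    \<open>{-1<..1}\<close> to the left of 0 carries no mass.\<close>
  have "{-1<..<0::real} = (\<Union>k. {-1<..-1 / real (Suc k)})"
  proof safe
    fix x :: real assume x: "x \<in> {-1<..<0}"
    then obtain k where "1 / real (Suc k) < - x" using nat_approx_posE[of "-x"] by auto
    then show "x \<in> (\<Union>k. {-1<..-1 / real (Suc k)})" using x by (intro UN_I[of k]) auto
  next
    fix x :: real and k assume "x \<in> {-1<..-1 / real (Suc k)}"
    moreover have "-1 / real (Suc k) < 0" by simp
    ultimately show "x \<in> {-1<..<0}" by (simp only: greaterThanAtMost_iff greaterThanLessThan_iff) (blast intro: le_less_trans)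
  qed
  moreover have "emeasure ?I (\<Union>k. {-1<..-1 / real (Suc k)}) = 0"
    by (rule emeasure_UN_eq_0) (auto simp: Ioc H_neg)
  ultimately have null: "{-1<..<0} \<in> null_sets ?I" by auto
  have cdf: "emeasure M {0..x} = ennreal (H x)" if x: "0 \<le> x" "x \<le> 1" for x
  proof -
    have "emeasure M {0..x} = emeasure ?I {0..x}"
      using x by (subst M) (auto intro!: arg_cong[where f="emeasure ?I"])
    also have "\<dots> = emeasure ?I ({0..x} \<union> {-1<..<0})"
      by (rule emeasure_Un_null_set[symmetric]) (use null in auto)
    also have "{0..x} \<union> {-1<..<0} = {-1<..x}" using x by auto
    finally show ?thesis using x by (simp add: Ioc H_neg)
  qed
  have H0: "0 \<le> H x" for x by (rule le_H) (rule pos)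
  show thesis
  proof (rule that)
    have "emeasure M UNIV = ennreal (H 1)" by (subst M) (auto simp: Ioc H_neg)
    moreover have "space M = UNIV" by (simp add: M_def)
    ultimately show "finite_measure M" by (intro finite_measureI) simp
    show "sets M = sets borel" by (simp add: M_def)
    show "measure M {0..1} \<le> C" using cdf[of 1] H0 H_le[of 1 2] le[of 2] by (simp add: measure_def)
    show "(G \<longlongrightarrow> measure M {0..x}) (at_right x)" if "0 \<le> x" "x \<le> 1" for x
      using cdf[OF that] H0 lim by (simp add: measure_def)
  qed
qed

text \<open>The \<open>m\<close>-th partition of the unit interval consists of \<open>Suc m\<close> left-open intervals of equal
  length; the point \<open>0\<close> belongs to the first one.\<close>

definition cell :: "nat \<Rightarrow> nat \<Rightarrow> real set" where
  "cell m j = {x. 0 \<le> x \<and> x \<le> 1 \<and> nat (\<lceil>real (Suc m) * x\<rceil> - 1) = j}"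

lemma disjoint_family_cell: "disjoint_family (cell m)"
  by (auto simp: disjoint_family_on_def cell_def)

text \<open>The hypothesis excludes the empty union, which is not \<open>{0..0}\<close>; the minimum
  covers numbers \<open>k\<close> beyond the last cell.\<close>

lemma UN_cell: "0 < k \<Longrightarrow> (\<Union>j<k. cell m j) = {0..min 1 (real k / real (Suc m))}"
proof -
  assume k: "0 < k"
  have "nat (\<lceil>real (Suc m) * x\<rceil> - 1) < k \<longleftrightarrow> x \<le> real k / real (Suc m)" for x
  proof -
    have "nat (\<lceil>real (Suc m) * x\<rceil> - 1) < k \<longleftrightarrow> \<lceil>real (Suc m) * x\<rceil> \<le> int k"
      using k by linarith
    also have "\<dots> \<longleftrightarrow> real (Suc m) * x \<le> real k"
      by (metis ceiling_le_iff of_int_of_nat_eq)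
    also have "\<dots> \<longleftrightarrow> x \<le> real k / real (Suc m)" by (simp add: field_simps)
    finally show ?thesis .
  qed
  then show ?thesis by (auto simp: cell_def)
qed

lemma cell_eq: "cell m j = (\<Union>i<Suc j. cell m i) - (\<Union>i<j. cell m i)"
  by (auto simp: cell_def less_Suc_eq)

lemma cell_borel01 [simp]: "cell m j \<in> borel01"
proof -
  have "(\<Union>i<k. cell m i) \<in> sets borel" for k
    by (cases "k = 0") (auto simp: UN_cell)
  then have "cell m j \<in> sets borel" by (subst cell_eq) blast
  then show ?thesis by (auto simp: borel01_def cell_def)
qed

lemma measure_lborel_cell:
  assumes "j \<le> m" shows "emeasure lborel (cell m j) = ennreal (1 / real (Suc m))"
proof (cases "j = 0")
  case True
  have "cell m 0 = (\<Union>i<Suc 0. cell m i)" by (simp add: lessThan_Suc)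
  also have "\<dots> = {0..1 / real (Suc m)}" by (subst UN_cell) auto
  finally show ?thesis using True by simp
next
  case False
  have "real (Suc j) / real (Suc m) \<le> 1" "real j / real (Suc m) \<le> 1" "0 \<le> real j / real (Suc m)"
    using assms by auto
  moreover have "{0..b} - {0..a} = {a<..b}" if "0 \<le> a" for a b :: real using that by auto
  ultimately have "cell m j = {real j / real (Suc m)<..real (Suc j) / real (Suc m)}"
    using False by (subst cell_eq) (simp only: UN_cell zero_less_Suc min_absorb2 neq0_conv)
  then show ?thesis by (simp add: divide_right_mono diff_divide_distrib[symmetric])
qed

lemma ext_norm_sum:
  assumes N: "ext_norm N" and "finite I"
  shows "N (\<Sum>i\<in>I. c i *\<^sub>R f i) \<le> (\<Sum>i\<in>I. ennreal \<bar>c i\<bar> * N (f i))"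
  using assms(2)
proof (induction I rule: finite_induct)
  case empty
  show ?case using ext_norm_scaleR[OF N, of 0 0] by simp
next
  case (insert i I)
  have "N (c i *\<^sub>R f i + (\<Sum>i\<in>I. c i *\<^sub>R f i)) \<le> N (c i *\<^sub>R f i) + N (\<Sum>i\<in>I. c i *\<^sub>R f i)"
    by (rule ext_norm_add[OF N])
  also have "\<dots> \<le> ennreal \<bar>c i\<bar> * N (f i) + (\<Sum>i\<in>I. ennreal \<bar>c i\<bar> * N (f i))"
    by (intro add_mono ext_norm_scaleR[OF N] insert)
  finally show ?case using insert by simp
qed

lemma sum_fun_apply: "(\<Sum>i\<in>I. f i) x = (\<Sum>i\<in>I. f i x)"
  by (induction I rule: infinite_finite_induct) auto

definition uniform_cell :: "nat \<Rightarrow> nat \<Rightarrow> real set \<Rightarrow> real" where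
  "uniform_cell m j A = (if A \<in> borel01 then measure (uniform_measure lborel (cell m j)) A else 0)"

lemma uniform_cell_cell:
  assumes "j \<le> m" shows "uniform_cell m j (cell m i) = (if i = j then 1 else 0)"
proof -
  have m: "cell m j \<in> sets lborel" using borel01_sets[OF cell_borel01] by simp
  have "cell m j \<inter> cell m i = (if i = j then cell m j else {})" by (auto simp: cell_def)
  then show ?thesis
    using m borel01_sets[OF cell_borel01, of m i] measure_lborel_cell[OF assms]
    by (simp add: uniform_cell_def measure_def divide_ennreal)
qed

lemma ac_norm_uniform_cell:
  assumes "j \<le> m" shows "ac_norm (uniform_cell m j) \<le> 1"
proof -
  have m: "cell m j \<in> sets lborel" using borel01_sets[OF cell_borel01] by simp
  let ?M = "uniform_measure lborel (cell m j)"
  have "emeasure ?M UNIV = 1"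
    using m measure_lborel_cell[OF assms] by (simp add: ennreal_divide_self)
  then have M1: "emeasure ?M UNIV = 1" "measure ?M UNIV = 1" by (auto simp: measure_def)
  interpret finite_measure ?M by (rule finite_measureI) (simp add: M1)
  have n: "finite_measure (null_measure borel)" by (rule finite_measureI) simp
  have eq: "uniform_cell m j = (\<lambda>A. if A \<in> borel01 then measure ?M A - measure (null_measure borel) A else 0)"
    by (simp add: fun_eq_iff uniform_cell_def)
  note * = finite_signed01_diff_measure[of ?M "null_measure borel", folded eq, OF finite_measure_axioms _ n]
  have "tv_norm (uniform_cell m j) \<le> ennreal (measure ?M {0..1})" using * by simp
  also have "\<dots> \<le> 1" using finite_measure_mono[of "{0..1}" UNIV] by (simp add: M1)
  finally have "tv_norm (uniform_cell m j) \<le> 1" .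
  moreover have "finite_signed01 (uniform_cell m j)" using * by simp
  moreover have "null_on_null (uniform_cell m j)"
    unfolding null_on_null_def
  proof (intro ballI impI)
    fix A assume A: "A \<in> borel01" "emeasure lborel A = 0"
    then have "emeasure lborel (cell m j \<inter> A) = 0"
      using emeasure_mono[of "cell m j \<inter> A" A lborel] borel01_sets[of A] by auto
    then show "uniform_cell m j A = 0"
      using A m borel01_sets[of A] by (simp add: uniform_cell_def measure_def)
  qed
  ultimately show ?thesis by (simp add: ac_norm_def)
qed

text \<open>The conditional expectation of \<open>\<mu>\<close> on the \<open>m\<close>-th
  partition: its density is constant on each cell, and each cell keeps its mass.\<close>

definition cell_average :: "(real set \<Rightarrow> real) \<Rightarrow> nat \<Rightarrow> real set \<Rightarrow> real" where
  "cell_average \<mu> m = (\<Sum>j\<le>m. \<mu> (cell m j) *\<^sub>R uniform_cell m j)"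

lemma cell_average_cell: "j \<le> m \<Longrightarrow> cell_average \<mu> m (cell m j) = \<mu> (cell m j)"
  by (simp add: cell_average_def sum_fun_apply uniform_cell_cell if_distrib cong: if_cong)

text \<open>A contraction at each level \<open>m\<close>, since the masses of disjoint cells add up
  in absolute value to at most the total variation.\<close>

lemma bounded_op_cell_average: "bounded_op M_norm (linf ac_norm) cell_average"
proof -
  have "bounded_op M_norm (linf ac_norm) (\<lambda>\<mu> m. cell_average \<mu> m)"
  proof (rule bounded_op_linf_lift[where C = 1])
    fix m \<mu> assume "M_norm \<mu> < \<infinity>"
    then have \<mu>: "finite_signed01 \<mu>" by (simp only: M_norm_finite_iff)
    have "ac_norm (cell_average \<mu> m) \<le> (\<Sum>j\<le>m. ennreal \<bar>\<mu> (cell m j)\<bar> * ac_norm (uniform_cell m j))"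
      unfolding cell_average_def by (rule ext_norm_sum[OF ext_norm_ac_norm]) simp
    also have "\<dots> \<le> (\<Sum>j\<le>m. ennreal \<bar>\<mu> (cell m j)\<bar> * 1)"
      by (intro sum_mono mult_left_mono ac_norm_uniform_cell) auto
    also have "\<dots> = ennreal (\<Sum>j\<le>m. \<bar>\<mu> (cell m j)\<bar>)" by simp
    also have "\<dots> \<le> tv_norm \<mu>"
      by (rule sum_abs_le_tv)
        (auto simp: finite_signed01_empty[OF \<mu>] intro: disjoint_family_on_mono[OF _ disjoint_family_cell])
    finally show "ac_norm (cell_average \<mu> m) \<le> ennreal 1 * M_norm \<mu>" using \<mu> by (simp add: M_norm_def)
  qed (auto simp: cell_average_def scaleR_add_left sum.distrib scaleR_sum_right)
  then show ?thesis .
qed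

section \<open>Distribution functions and their recovery from the averages\<close>

lemma finite_signed01_right_continuous:
  assumes \<mu>: "finite_signed01 \<mu>" and x: "0 \<le> x" and e: "0 < (e::real)"
  obtains d where "0 < d" "\<And>y. x \<le> y \<Longrightarrow> y < x + d \<Longrightarrow> y \<le> 1 \<Longrightarrow> \<bar>\<mu> {0..y} - \<mu> {0..x}\<bar> < e"
proof -
  let ?M = "var_measure \<mu>"
  interpret finite_measure ?M by (rule finite_var_measure[OF \<mu>])
  have "(\<lambda>k. measure ?M {x<..x + 1 / real (Suc k)}) \<longlonglongrightarrow> measure ?M (\<Inter>k. {x<..x + 1 / real (Suc k)})"
  proof (rule finite_Lim_measure_decseq)
    have "1 / real (Suc n) \<le> 1 / real (Suc m)" if "m \<le> n" for m n :: nat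
      using that by (intro frac_le) auto
    then show "decseq (\<lambda>k. {x<..x + 1 / real (Suc k)})"
      unfolding decseq_def
      by (intro allI impI subsetI) (simp only: greaterThanAtMost_iff, meson add_left_mono order_trans)
  qed auto
  also have "(\<Inter>k. {x<..x + 1 / real (Suc k)}) = {}"
  proof -
    have "\<exists>k. y \<notin> {x<..x + 1 / real (Suc k)}" for y
    proof (cases "x < y")
      case True
      then obtain k where "1 / real (Suc k) < y - x" using nat_approx_posE[of "y - x"] by auto
      then show ?thesis by (intro exI[of _ k]) auto
    qed auto
    then show ?thesis by blast
  qed
  finally have "(\<lambda>k. measure ?M {x<..x + 1 / real (Suc k)}) \<longlonglongrightarrow> 0" by simp
  then have "eventually (\<lambda>k. measure ?M {x<..x + 1 / real (Suc k)} < e) sequentially"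
    using e by (rule order_tendstoD)
  then obtain k where k: "measure ?M {x<..x + 1 / real (Suc k)} < e"
    by (auto simp: eventually_sequentially)
  show thesis
  proof (rule that[of "1 / real (Suc k)"])
    fix y assume y: "x \<le> y" "y < x + 1 / real (Suc k)" "y \<le> 1"
    have b: "{0..y} \<in> borel01" "{0..x} \<in> borel01" "{x<..y} \<in> borel01"
      using x y by (auto simp: borel01_def)
    have "{0..y} - {0..x} = {x<..y}" using x y by auto
    then have "\<mu> {0..y} - \<mu> {0..x} = \<mu> {x<..y}"
      using finite_signed01_Diff[OF \<mu> b(1,2)] y by simp
    also have "\<bar>\<dots>\<bar> \<le> measure ?M {x<..y}" by (rule abs_le_var_measure[OF \<mu> b(3)])
    also have "\<dots> \<le> measure ?M {x<..x + 1 / real (Suc k)}"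
      using y by (intro finite_measure_mono) auto
    finally show "\<bar>\<mu> {0..y} - \<mu> {0..x}\<bar> < e" using k by simp
  qed simp
qed

text \<open>The number of cells contained in \<open>{0..q}\<close>; it is 0 for negative
  \<open>q\<close>, by the truncation in \<open>nat\<close>, and never exceeds
  \<open>Suc m\<close>.\<close>

definition cells_upto :: "nat \<Rightarrow> real \<Rightarrow> nat" where
  "cells_upto m q = min (Suc m) (nat \<lfloor>real (Suc m) * q\<rfloor>)"

lemma cells_upto_mono: "p \<le> q \<Longrightarrow> cells_upto m p \<le> cells_upto m q"
  unfolding cells_upto_def
  by (intro min.mono order_refl nat_mono floor_mono mult_left_mono) auto

text \<open>Rounding \<open>q\<close> down to whole cells loses less than one cell length, which for
  large \<open>m\<close> is below \<open>q - x\<close>; so the rounded point has not yet passed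
  \<open>x\<close>.\<close>

lemma cells_upto_eventually:
  assumes x: "0 \<le> x" "x \<le> 1" and q: "x < q"
  obtains k where "\<And>m. k \<le> m \<Longrightarrow> 0 < cells_upto m q \<and> x \<le> real (cells_upto m q) / real (Suc m)
      \<and> real (cells_upto m q) / real (Suc m) \<le> min 1 q"
proof -
  obtain k where k: "1 / real (Suc k) < q - x" using nat_approx_posE[of "q - x"] q by auto
  show thesis
  proof (rule that[of k])
    fix m assume m: "k \<le> m"
    let ?n = "real (Suc m)"
    have "1 / ?n \<le> 1 / real (Suc k)" using m by (intro frac_le) auto
    then have "1 / ?n < q - x" using k by simp
    then have *: "1 + ?n * x < ?n * q" by (simp add: field_simps)
    let ?f = "nat \<lfloor>?n * q\<rfloor>"
    have nx: "0 \<le> ?n * x" using x by simp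
    have f: "real ?f \<le> ?n * q" "?n * q < real ?f + 1" using * nx by linarith+
    have f1: "?n * x < real ?f" "0 < ?f" using f * nx by linarith+
    have K: "real (cells_upto m q) = min ?n (real ?f)" by (simp add: cells_upto_def)
    have "?n * x \<le> real (cells_upto m q)" using f1(1) mult_left_mono[OF x(2), of ?n] unfolding K by simp
    moreover have "real (cells_upto m q) \<le> ?n" "real (cells_upto m q) \<le> ?n * q" using f(1) unfolding K by auto
    moreover have "0 < cells_upto m q" using f1(2) by (simp add: cells_upto_def)
    ultimately show "0 < cells_upto m q \<and> x \<le> real (cells_upto m q) / ?n \<and> real (cells_upto m q) / ?n \<le> min 1 q"
      by (auto simp: pos_le_divide_eq pos_divide_le_eq mult.commute)
  qed
qed

definition initial_cells :: "nat \<Rightarrow> real \<Rightarrow> real set" where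
  "initial_cells m q = (\<Union>j<cells_upto m q. cell m j)"

lemma finite_signed01_initial_cells:
  "finite_signed01 \<nu> \<Longrightarrow> \<nu> (initial_cells m q) = (\<Sum>j<cells_upto m q. \<nu> (cell m j))"
  unfolding initial_cells_def by (intro finite_signed01_UN_lessThan cell_borel01 disjoint_family_cell)

text \<open>The reason for testing measures on whole cells and not on \<open>{0..q}\<close>:
  averaging preserves the mass of every cell, hence of every union of cells.\<close>

lemma cell_average_initial_cells:
  assumes "finite_signed01 \<mu>" "finite_signed01 (cell_average \<mu> m)"
  shows "cell_average \<mu> m (initial_cells m q) = \<mu> (initial_cells m q)"
proof -
  have "j \<le> m" if "j < cells_upto m q" for j using that by (simp add: cells_upto_def)
  then show ?thesis
    by (simp add: finite_signed01_initial_cells[OF assms(1)] finite_signed01_initial_cells[OF assms(2)]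
        cell_average_cell)
qed

text \<open>Left inverse of averaging: the weak* limit along an ultrafilter, obtained through the
  distribution functions.  The distribution function of the limit measure is the right limit of the
  limits \<open>G \<nu>\<close>; it is written as a difference of two monotone functions, which come
  from the positive and the negative parts of the cell values.\<close>

lemma complemented_M_linf_ac: "complemented M_norm (linf ac_norm)"
proof -
  obtain U :: "nat filter" where U: "U \<noteq> bot" "U \<le> sequentially"
    and Ulim: "\<And>f::nat \<Rightarrow> real. (\<exists>C. \<forall>n. \<bar>f n\<bar> \<le> C) \<Longrightarrow> \<exists>l. (f \<longlongrightarrow> l) U"
    using ex_ultralimit by blast
  define G where "G \<nu> q = Lim U (\<lambda>m. \<nu> m (initial_cells m q))" for \<nu> :: "nat \<Rightarrow> real set \<Rightarrow> real" and q
  \<comment> \<open>\<open>G \<nu>\<close> need not be right-continuous, so a limit measure is tied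
    to it by right limits. Such a measure is unique, and the relation respects sums and multiples;
    the linearity of \<open>T\<close> rests on this.\<close>
  define R where "R \<nu> \<mu> \<longleftrightarrow> finite_signed01 \<mu> \<and>
      (\<forall>x. 0 \<le> x \<longrightarrow> x \<le> 1 \<longrightarrow> (G \<nu> \<longlongrightarrow> \<mu> {0..x}) (at_right x))" for \<nu> \<mu>
  have signed: "finite_signed01 (\<nu> m)" if "linf ac_norm \<nu> < \<infinity>" for \<nu> m
    using linf_nth_finite[OF that, of m] unfolding ac_norm_finite_iff by blast
  define C where "C \<nu> = enn2real (linf ac_norm \<nu>)" for \<nu>
  have C0: "0 \<le> C \<nu>" for \<nu> by (simp add: C_def)
  have C: "ennreal (C \<nu>) = linf ac_norm \<nu>" if "linf ac_norm \<nu> < \<infinity>" for \<nu>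
    using that by (simp add: C_def)
  have bound: "(\<Sum>j<k. \<bar>\<nu> m (cell m j)\<bar>) \<le> C \<nu>" if "linf ac_norm \<nu> < \<infinity>" for \<nu> m k
  proof -
    have "ennreal (\<Sum>j<k. \<bar>\<nu> m (cell m j)\<bar>) \<le> tv_norm (\<nu> m)"
      by (rule sum_abs_le_tv)
        (auto simp: finite_signed01_empty[OF signed[OF that]] intro: disjoint_family_on_mono[OF _ disjoint_family_cell])
    also have "\<dots> = ac_norm (\<nu> m)"
      using linf_nth_finite[OF that, of m] unfolding ac_norm_finite_iff by (simp add: ac_norm_def)
    also have "\<dots> \<le> ennreal (C \<nu>)" by (simp add: C[OF that] linf_nth_le)
    finally show ?thesis by (simp add: C0)
  qed
  have G: "((\<lambda>m. \<nu> m (initial_cells m q)) \<longlongrightarrow> G \<nu> q) U" if "linf ac_norm \<nu> < \<infinity>" for \<nu> q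
  proof -
    have "\<bar>\<nu> m (initial_cells m q)\<bar> \<le> C \<nu>" for m
      unfolding finite_signed01_initial_cells[OF signed[OF that]]
      by (rule order_trans[OF sum_abs bound[OF that]])
    then obtain l where "((\<lambda>m. \<nu> m (initial_cells m q)) \<longlongrightarrow> l) U"
      using Ulim[of "\<lambda>m. \<nu> m (initial_cells m q)"] by blast
    then show ?thesis using tendsto_Lim[OF U(1)] unfolding G_def by blast
  qed
  have unique: "\<mu> = \<mu>'" if "R \<nu> \<mu>" "R \<nu> \<mu>'" for \<nu> \<mu> \<mu>'
  proof (rule finite_signed01_eqI)
    fix x :: real assume x: "0 \<le> x" "x \<le> 1"
    show "\<mu> {0..x} = \<mu>' {0..x}"
      using that x tendsto_unique[of "at_right x" "G \<nu>"] by (simp add: R_def)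
  qed (use that in \<open>auto simp: R_def\<close>)
  \<comment> \<open>With \<open>s\<close> equal to 1 or -1 the summands are the positive or the
    negative parts of the cell values. Being nonnegative, they make the sums monotone in
    \<open>q\<close>, which \<open>G \<nu>\<close> itself need not be.\<close>
  have part: "\<exists>P M. (\<forall>q. ((\<lambda>m. \<Sum>j<cells_upto m q. max 0 (s * \<nu> m (cell m j))) \<longlongrightarrow> P q) U) \<and>
      finite_measure M \<and> sets M = sets borel \<and> measure M {0..1} \<le> C \<nu> \<and>
      (\<forall>x. 0 \<le> x \<longrightarrow> x \<le> 1 \<longrightarrow> (P \<longlongrightarrow> measure M {0..x}) (at_right x))"
    if \<nu>: "linf ac_norm \<nu> < \<infinity>" and s: "\<bar>s\<bar> = 1" for \<nu> and s :: real
  proof -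
    define p where "p m q = (\<Sum>j<cells_upto m q. max 0 (s * \<nu> m (cell m j)))" for m q
    have p0: "0 \<le> p m q" for m q unfolding p_def by (intro sum_nonneg) auto
    have p_le: "p m q \<le> C \<nu>" for m q
    proof -
      have "p m q \<le> (\<Sum>j<cells_upto m q. \<bar>\<nu> m (cell m j)\<bar>)"
        unfolding p_def
      proof (rule sum_mono)
        fix j
        have "\<bar>s * \<nu> m (cell m j)\<bar> = \<bar>\<nu> m (cell m j)\<bar>" by (simp add: abs_mult s)
        then show "max 0 (s * \<nu> m (cell m j)) \<le> \<bar>\<nu> m (cell m j)\<bar>" by linarith
      qed
      then show ?thesis using bound[OF \<nu>] order_trans by blast
    qed
    have p_mono: "p m q \<le> p m q'" if "q \<le> q'" for m q q'
      unfolding p_def using cells_upto_mono[OF that, of m] by (intro sum_mono2) auto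
    have "\<exists>l. ((\<lambda>m. p m q) \<longlongrightarrow> l) U" for q
      by (rule Ulim) (use p0 p_le in \<open>auto intro!: exI[of _ "C \<nu>"]\<close>)
    then obtain P where P: "\<And>q. ((\<lambda>m. p m q) \<longlongrightarrow> P q) U" by metis
    have neg: "P q = 0" if "q < 0" for q
    proof -
      have "real (Suc m) * q < 0" for m using that by (simp add: mult_pos_neg del: of_nat_Suc)
      then have "\<lfloor>real (Suc m) * q\<rfloor> \<le> 0" for m by (simp only: floor_le_zero) (meson less_trans zero_less_one)
      then have "cells_upto m q = 0" for m by (simp add: cells_upto_def del: of_nat_Suc)
      then have "((\<lambda>m. p m q) \<longlongrightarrow> 0) U" by (simp add: p_def)
      then show ?thesis using P tendsto_unique[OF U(1)] by blast
    qed
    obtain M where "finite_measure M" "sets M = sets borel" "measure M {0..1} \<le> C \<nu>"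
      "\<And>x. 0 \<le> x \<Longrightarrow> x \<le> 1 \<Longrightarrow> (P \<longlongrightarrow> measure M {0..x}) (at_right x)"
    proof (rule monotone_limit_measure[of P "C \<nu>"])
      show "P q \<le> P q'" if "q \<le> q'" for q q'
        by (rule tendsto_le[OF U(1) P P]) (simp add: p_mono[OF that])
      show "0 \<le> P q" for q by (rule tendsto_lowerbound[OF P _ U(1)]) (simp add: p0)
      show "P q \<le> C \<nu>" for q by (rule tendsto_upperbound[OF P _ U(1)]) (simp add: p_le)
    qed (use neg in auto)
    then show ?thesis using P unfolding p_def by blast
  qed
  have ex: "\<exists>\<mu>. R \<nu> \<mu> \<and> M_norm \<mu> \<le> ennreal 2 * linf ac_norm \<nu>" if \<nu>: "linf ac_norm \<nu> < \<infinity>" for \<nu>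
  proof -
    obtain P M where P: "\<And>q. ((\<lambda>m. \<Sum>j<cells_upto m q. max 0 (1 * \<nu> m (cell m j))) \<longlongrightarrow> P q) U"
      and M: "finite_measure M" "sets M = sets borel" "measure M {0..1} \<le> C \<nu>"
      and PM: "\<And>x. 0 \<le> x \<Longrightarrow> x \<le> 1 \<Longrightarrow> (P \<longlongrightarrow> measure M {0..x}) (at_right x)"
      using part[OF \<nu>, of 1] by auto
    obtain Q N where Q: "\<And>q. ((\<lambda>m. \<Sum>j<cells_upto m q. max 0 (- 1 * \<nu> m (cell m j))) \<longlongrightarrow> Q q) U"
      and N: "finite_measure N" "sets N = sets borel" "measure N {0..1} \<le> C \<nu>"
      and QN: "\<And>x. 0 \<le> x \<Longrightarrow> x \<le> 1 \<Longrightarrow> (Q \<longlongrightarrow> measure N {0..x}) (at_right x)"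
      using part[OF \<nu>, of "-1"] by auto
    have "G \<nu> q = P q - Q q" for q
    proof -
      have "((\<lambda>m. (\<Sum>j<cells_upto m q. max 0 (1 * \<nu> m (cell m j))) -
          (\<Sum>j<cells_upto m q. max 0 (- 1 * \<nu> m (cell m j)))) \<longlongrightarrow> P q - Q q) U"
        by (intro tendsto_diff P Q)
      moreover have "(\<Sum>j<cells_upto m q. max 0 (1 * \<nu> m (cell m j))) -
          (\<Sum>j<cells_upto m q. max 0 (- 1 * \<nu> m (cell m j))) = \<nu> m (initial_cells m q)" for m
        unfolding finite_signed01_initial_cells[OF signed[OF \<nu>]] sum_subtractf[symmetric]
        by (intro sum.cong) auto
      ultimately show ?thesis using G[OF \<nu>, of q] tendsto_unique[OF U(1)] by simp
    qed
    then have GPQ: "G \<nu> = (\<lambda>q. P q - Q q)" by blast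
    define \<mu> where "\<mu> = (\<lambda>A. if A \<in> borel01 then measure M A - measure N A else 0)"
    note * = finite_signed01_diff_measure[OF M(1,2) N(1,2), folded \<mu>_def]
    have "R \<nu> \<mu>"
      unfolding R_def
    proof (intro conjI allI impI *)
      fix x :: real assume x: "0 \<le> x" "x \<le> 1"
      then have "{0..x} \<in> borel01" by (auto simp: borel01_def)
      then show "(G \<nu> \<longlongrightarrow> \<mu> {0..x}) (at_right x)"
        unfolding GPQ \<mu>_def using tendsto_diff[OF PM[OF x] QN[OF x]] by simp
    qed
    \<comment> \<open>The two parts are bounded by \<open>C \<nu>\<close> separately, whence the
      factor 2.\<close>
    moreover have "M_norm \<mu> \<le> ennreal 2 * linf ac_norm \<nu>"
    proof -
      have "M_norm \<mu> \<le> ennreal (measure M {0..1} + measure N {0..1})" using * by (simp add: M_norm_def)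
      also have "\<dots> \<le> ennreal (2 * C \<nu>)" using M(3) N(3) by (intro ennreal_leI) simp
      also have "\<dots> = ennreal 2 * linf ac_norm \<nu>" by (subst ennreal_mult) (auto simp: C0 C[OF \<nu>])
      finally show ?thesis .
    qed
    ultimately show ?thesis by blast
  qed
  define T where "T \<nu> = (THE \<mu>. R \<nu> \<mu>)" for \<nu>
  have T_eq: "T \<nu> = \<mu>" if "R \<nu> \<mu>" for \<nu> \<mu>
    unfolding T_def using that unique by blast
  have T: "R \<nu> (T \<nu>)" "M_norm (T \<nu>) \<le> ennreal 2 * linf ac_norm \<nu>" if "linf ac_norm \<nu> < \<infinity>" for \<nu>
    using ex[OF that] T_eq by auto
  note fin = ext_norm_linf[OF ext_norm_ac_norm]
  have "bounded_op (linf ac_norm) M_norm T"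
  proof (rule bounded_opI[where C = 2])
    fix x y assume x: "linf ac_norm x < \<infinity>" and y: "linf ac_norm y < \<infinity>"
    have "G (x + y) q = G x q + G y q" for q
      using tendsto_unique[OF U(1) G[OF ext_norm_add_finite[OF fin, OF x y], of q]] tendsto_add[OF G[OF x, of q] G[OF y, of q]]
      by simp
    then have "G (x + y) = (\<lambda>q. G x q + G y q)" by blast
    then have "R (x + y) (T x + T y)"
      using T(1)[OF x] T(1)[OF y] by (simp add: R_def finite_signed01_add tendsto_add)
    then show "T (x + y) = T x + T y" by (rule T_eq)
  next
    fix a x assume x: "linf ac_norm x < \<infinity>"
    have "G (a *\<^sub>R x) q = a * G x q" for q
      using tendsto_unique[OF U(1) G[OF ext_norm_scaleR_finite[OF fin, OF x], of a q]] tendsto_mult_left[OF G[OF x, of q], of a]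
      by simp
    then have "G (a *\<^sub>R x) = (\<lambda>q. a * G x q)" by blast
    then have "R (a *\<^sub>R x) (a *\<^sub>R T x)"
      using T(1)[OF x] by (simp add: R_def finite_signed01_scaleR tendsto_mult_left)
    then show "T (a *\<^sub>R x) = a *\<^sub>R T x" by (rule T_eq)
  qed (use T in auto)
  moreover have "T (cell_average \<mu>) = \<mu>" if "M_norm \<mu> < \<infinity>" for \<mu>
  proof (rule T_eq)
    have \<mu>: "finite_signed01 \<mu>" using that by (simp only: M_norm_finite_iff)
    have a: "linf ac_norm (cell_average \<mu>) < \<infinity>" by (rule bounded_op_finite[OF bounded_op_cell_average, OF that])
    have G\<mu>: "((\<lambda>m. \<mu> (initial_cells m q)) \<longlongrightarrow> G (cell_average \<mu>) q) U" for q
      using G[OF a, of q] by (simp add: cell_average_initial_cells[OF \<mu> signed[OF a]])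
    have "(G (cell_average \<mu>) \<longlongrightarrow> \<mu> {0..x}) (at_right x)" if x: "0 \<le> x" "x \<le> 1" for x
    proof (rule tendstoI)
      fix e :: real assume e: "0 < e"
      \<comment> \<open>Only a non-strict bound survives the limit along \<open>U\<close>, hence
        \<open>e / 2\<close>.\<close>
      obtain d where d: "0 < d" "\<And>y. x \<le> y \<Longrightarrow> y < x + d \<Longrightarrow> y \<le> 1 \<Longrightarrow> \<bar>\<mu> {0..y} - \<mu> {0..x}\<bar> < e / 2"
        using finite_signed01_right_continuous[OF \<mu> x(1), of "e / 2"] e by auto
      have "dist (G (cell_average \<mu>) q) (\<mu> {0..x}) < e" if q: "x < q" "q < x + d" for q
      proof -
        obtain k where k: "\<And>m. k \<le> m \<Longrightarrow> 0 < cells_upto m q \<and> x \<le> real (cells_upto m q) / real (Suc m)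
            \<and> real (cells_upto m q) / real (Suc m) \<le> min 1 q"
          using cells_upto_eventually[OF x q(1)] by blast
        have "\<bar>\<mu> (initial_cells m q) - \<mu> {0..x}\<bar> \<le> e / 2" if "k \<le> m" for m
        proof -
          \<comment> \<open>The union of the counted cells is \<open>{0..?y}\<close> with
            \<open>?y\<close> between \<open>x\<close> and \<open>q\<close>, where right continuity
            of \<open>\<mu>\<close> applies.\<close>
          let ?y = "real (cells_upto m q) / real (Suc m)"
          have "initial_cells m q = {0..?y}"
            using k[OF that] UN_cell[of "cells_upto m q" m] by (simp add: initial_cells_def min_absorb2)
          moreover have "\<bar>\<mu> {0..?y} - \<mu> {0..x}\<bar> < e / 2"
            using k[OF that] q by (intro d(2)) auto
          ultimately show ?thesis by simp
        qed
        then have "eventually (\<lambda>m. \<bar>\<mu> (initial_cells m q) - \<mu> {0..x}\<bar> \<le> e / 2) U"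
          by (intro filter_leD[OF U(2)] eventually_sequentiallyI[of k])
        then have "\<bar>G (cell_average \<mu>) q - \<mu> {0..x}\<bar> \<le> e / 2"
          using tendsto_rabs[OF tendsto_diff[OF G\<mu>[of q] tendsto_const[of "\<mu> {0..x}"]]]
          by (intro tendsto_upperbound[OF _ _ U(1)])
        then show ?thesis using e by (simp add: dist_real_def)
      qed
      then show "\<forall>\<^sub>F q in at_right x. dist (G (cell_average \<mu>) q) (\<mu> {0..x}) < e"
        unfolding eventually_at_right_field using d(1) by (intro exI[of _ "x + d"]) auto
    qed
    then show "R (cell_average \<mu>) \<mu>" using \<mu> by (simp add: R_def)
  qed
  ultimately show ?thesis unfolding complemented_def using bounded_op_cell_average by blast
qed

section \<open>Indefinite integrals\<close>

definition indefinite_integral01 :: "(real \<Rightarrow> real) \<Rightarrow> real set \<Rightarrow> real" where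
  "indefinite_integral01 g A = (if A \<in> borel01 then (LINT x:A|lebesgue. g x) else 0)"

text \<open>The map from functions to measures is isometric: the bound from above splits
  \<open>g\<close> into its positive and negative parts, the bound from below tests on the sets
  where \<open>g\<close> is positive and where it is not.\<close>

lemma indefinite_integral01:
  assumes g: "set_integrable lebesgue {0..1} g"
  shows "finite_signed01 (indefinite_integral01 g)" "null_on_null (indefinite_integral01 g)"
    and "tv_norm (indefinite_integral01 g) = (\<integral>\<^sup>+x\<in>{0..1}. ennreal \<bar>g x\<bar> \<partial>lebesgue)"
proof -
  define h where "h x = indicator {0..1} x * g x" for x
  have h: "integrable lebesgue h" using g by (simp add: set_integrable_def h_def[abs_def])
  then have hm [measurable]: "h \<in> borel_measurable lebesgue" by simp
  have hA: "integrable lebesgue (\<lambda>x. indicator A x * h x)" if "A \<in> borel01" for A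
    using integrable_mult_indicator[OF _ h, of A] borel01_sets[OF that] by simp
  have eq: "indefinite_integral01 g A = (LINT x|lebesgue. indicator A x * h x)" if "A \<in> borel01" for A
    using that borel01_subset[OF that]
    by (auto simp: indefinite_integral01_def set_lebesgue_integral_def h_def indicator_def intro!: Bochner_Integration.integral_cong)
  \<comment> \<open>\<open>ennreal\<close> cuts off negative values, so \<open>M 1\<close> and
    \<open>M (- 1)\<close> have the positive and the negative part of \<open>h\<close> as densities.
    The image under the identity restricts them to the Borel sets.\<close>
  define M where "M s = distr (density lebesgue (\<lambda>x. ennreal (s * h x))) borel (\<lambda>x. x)" for s :: real
  have idm: "(\<lambda>x. x) \<in> measurable (density lebesgue (\<lambda>x. ennreal (s * h x))) borel" for s
    by (simp add: measurable_completion)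
  have M: "emeasure (M s) A = (\<integral>\<^sup>+x. ennreal (s * (indicator A x * h x)) \<partial>lebesgue)" if "A \<in> sets borel" for s A
  proof -
    have "emeasure (M s) A = (\<integral>\<^sup>+x. ennreal (s * h x) * indicator A x \<partial>lebesgue)"
      unfolding M_def using that by (simp add: emeasure_distr[OF idm] emeasure_density)
    also have "\<dots> = (\<integral>\<^sup>+x. ennreal (s * (indicator A x * h x)) \<partial>lebesgue)"
      by (intro nn_integral_cong) (auto simp: indicator_def)
    finally show ?thesis .
  qed
  have abs: "(\<integral>\<^sup>+x. ennreal \<bar>h x\<bar> \<partial>lebesgue) = (\<integral>\<^sup>+x\<in>{0..1}. ennreal \<bar>g x\<bar> \<partial>lebesgue)"
    by (intro nn_integral_cong) (auto simp: h_def indicator_def)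
  have fin: "(\<integral>\<^sup>+x. ennreal \<bar>h x\<bar> \<partial>lebesgue) < \<infinity>"
    using h by (simp add: integrable_iff_bounded)
  have finM: "finite_measure (M s)" if "\<bar>s\<bar> = 1" for s
  proof (rule finite_measureI)
    have "emeasure (M s) UNIV \<le> (\<integral>\<^sup>+x. ennreal \<bar>h x\<bar> \<partial>lebesgue)"
    proof (subst M, simp, intro nn_integral_mono ennreal_leI)
      fix x
      have "\<bar>s * h x\<bar> = \<bar>h x\<bar>" using that by (simp add: abs_mult)
      then show "s * (indicator UNIV x * h x) \<le> \<bar>h x\<bar>" by simp
    qed
    then show "emeasure (M s) (space (M s)) \<noteq> \<infinity>" using fin by (auto simp: M_def)
  qed
  have sM: "sets (M s) = sets borel" for s by (simp add: M_def)
  have diff: "indefinite_integral01 g = (\<lambda>A. if A \<in> borel01 then measure (M 1) A - measure (M (- 1)) A else 0)"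
  proof
    fix A
    show "indefinite_integral01 g A = (if A \<in> borel01 then measure (M 1) A - measure (M (- 1)) A else 0)"
    proof (cases "A \<in> borel01")
      case True
      then show ?thesis
        using eq[OF True] hA[OF True] borel01_sets[OF True]
        by (simp add: real_lebesgue_integral_def measure_def M)
    qed (simp add: indefinite_integral01_def)
  qed
  note * = finite_signed01_diff_measure[OF finM sM finM sM, of 1 "-1", folded diff]
  show fs: "finite_signed01 (indefinite_integral01 g)" using * by simp
  have ub: "tv_norm (indefinite_integral01 g) \<le> (\<integral>\<^sup>+x. ennreal \<bar>h x\<bar> \<partial>lebesgue)"
  proof -
    interpret M1: finite_measure "M 1" by (rule finM) simp
    interpret M2: finite_measure "M (-1)" by (rule finM) simp
    have [measurable]: "(\<lambda>x. indicator {0..1} x * h x) \<in> borel_measurable lebesgue"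
      using hA[OF borel01_Icc] by (rule borel_measurable_integrable)
    have "tv_norm (indefinite_integral01 g) \<le> emeasure (M 1) {0..1} + emeasure (M (- 1)) {0..1}"
      using * by (simp add: M1.emeasure_eq_measure M2.emeasure_eq_measure)
    also have "\<dots> = (\<integral>\<^sup>+x. ennreal (1 * (indicator {0..1} x * h x)) + ennreal (- 1 * (indicator {0..1} x * h x)) \<partial>lebesgue)"
      by (subst M, simp, subst M, simp, rule nn_integral_add[symmetric]) measurable
    also have "\<dots> = (\<integral>\<^sup>+x. ennreal \<bar>h x\<bar> \<partial>lebesgue)"
      by (intro nn_integral_cong) (auto simp: h_def indicator_def abs_real_def ennreal_neg)
    finally show ?thesis .
  qed
  have lb: "(\<integral>\<^sup>+x. ennreal \<bar>h x\<bar> \<partial>lebesgue) \<le> tv_norm (indefinite_integral01 g)"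
  proof -
    let ?\<nu> = "indefinite_integral01 g"
    \<comment> \<open>\<open>h\<close> is only Lebesgue measurable, but the sets in the variation
      must be Borel; the signs are therefore read off from a Borel function that equals
      \<open>h\<close> almost everywhere.\<close>
    obtain k where k [measurable]: "k \<in> borel_measurable lborel" and hk: "AE x in lborel. h x = k x"
      using completion_ex_borel_measurable_real[OF hm] by blast
    have hk': "AE x in lebesgue. h x = k x" using hk by (rule AE_completion)
    define S where "S = {x \<in> {0..1}. 0 < k x}"
    define R where "R = {x \<in> {0..1}. k x \<le> 0}"
    have kb: "k \<in> borel_measurable borel" using k by simp
    have "S = {0..1} \<inter> {x \<in> space borel. 0 < k x}" "R = {0..1} \<inter> {x \<in> space borel. k x \<le> 0}"
      by (auto simp: S_def R_def)
    then have S: "S \<in> borel01" and R: "R \<in> borel01"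
      using kb by (auto simp: borel01_def intro!: sets.Int borel_measurable_less borel_measurable_le)
    have "(\<integral>\<^sup>+x. ennreal \<bar>h x\<bar> \<partial>lebesgue) = ennreal (LINT x|lebesgue. \<bar>h x\<bar>)"
      using h by (intro nn_integral_eq_integral) auto
    also have "(LINT x|lebesgue. \<bar>h x\<bar>) = (LINT x|lebesgue. indicator S x * h x - indicator R x * h x)"
    proof (rule integral_cong_AE)
      show "AE x in lebesgue. \<bar>h x\<bar> = indicator S x * h x - indicator R x * h x"
        using hk'
      proof eventually_elim
        case (elim x)
        then show ?case by (auto simp: S_def R_def h_def indicator_def)
      qed
    qed (use borel01_sets[OF S] borel01_sets[OF R] in \<open>auto intro!: borel_measurable_times borel_measurable_diff borel_measurable_indicator\<close>)
    also have "\<dots> = ?\<nu> S - ?\<nu> R"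
      using Bochner_Integration.integral_diff[OF hA[OF S] hA[OF R]] by (simp add: eq S R)
    also have "ennreal (?\<nu> S - ?\<nu> R) \<le> ennreal \<bar>?\<nu> S\<bar> + ennreal \<bar>?\<nu> R\<bar>"
      by (simp add: ennreal_leI flip: ennreal_plus)
    also have "\<dots> \<le> var_on ?\<nu> S + var_on ?\<nu> R"
      by (intro add_mono abs_le_var_on S R order_refl)
    also have "\<dots> \<le> var_on ?\<nu> (S \<union> R)"
      by (rule var_on_superadditive[of ?\<nu>, OF finite_signed01_empty[OF fs]]) (auto simp: S_def R_def)
    also have "\<dots> \<le> tv_norm ?\<nu>"
      unfolding tv_norm_def by (rule var_on_mono) (auto simp: S_def R_def)
    finally show ?thesis .
  qed
  show "tv_norm (indefinite_integral01 g) = (\<integral>\<^sup>+x\<in>{0..1}. ennreal \<bar>g x\<bar> \<partial>lebesgue)"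
    using ub lb abs by simp
  show "null_on_null (indefinite_integral01 g)"
    unfolding null_on_null_def
  proof (intro ballI impI)
    fix A assume A: "A \<in> borel01" "emeasure lborel A = 0"
    then have "A \<in> null_sets lborel" using borel01_sets by auto
    then have "AE x in lebesgue. x \<notin> A" by (intro AE_completion AE_not_in)
    then have "AE x in lebesgue. indicator A x * h x = 0" by eventually_elim simp
    then show "indefinite_integral01 g A = 0" unfolding eq[OF A(1)] by (rule integral_eq_zero_AE)
  qed
qed

lemma finite_measure_Radon_Nikodym_real:
  assumes N: "finite_measure N" "sets N = sets borel"
    and ac: "\<And>A. A \<in> sets borel \<Longrightarrow> emeasure lborel A = 0 \<Longrightarrow> emeasure N A = 0"
  obtains g :: "real \<Rightarrow> real" where "g \<in> borel_measurable borel" "integrable lborel g"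
    "\<And>A. A \<in> sets borel \<Longrightarrow> measure N A = (LINT x:A|lborel. g x)"
proof -
  interpret N: finite_measure N by fact
  have a: "absolutely_continuous lborel N"
    unfolding absolutely_continuous_def using ac N(2) by (auto simp: null_sets_def)
  have s: "sets N = sets lborel" by (simp add: N(2))
  define g where "g x = enn2real (RN_deriv lborel N x)" for x
  have g [measurable]: "g \<in> borel_measurable lborel" unfolding g_def by measurable
  note I = sigma_finite_measure.RN_deriv_integrable[OF sigma_finite_lborel N.sigma_finite_measure_axioms a s, folded g_def]
    sigma_finite_measure.RN_deriv_integral[OF sigma_finite_lborel N.sigma_finite_measure_axioms a s, folded g_def]
  have space: "space N = UNIV" using sets_eq_imp_space_eq[OF N(2)] by simp
  show thesis
  proof (rule that)
    show "g \<in> borel_measurable borel" using g by simp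
    show "integrable lborel g" using I(1)[of "\<lambda>_. 1"] by simp
    fix A :: "real set" assume A: "A \<in> sets borel"
    then have "integral\<^sup>L N (indicator A) = (LINT x|lborel. g x * indicator A x)" by (intro I(2)) simp
    then show "measure N A = (LINT x:A|lborel. g x)"
      using A by (simp add: space set_lebesgue_integral_def mult.commute)
  qed
qed

text \<open>Radon-Nikodym is applied to the variation and to the measure subtracted from it.
  Lebesgue null sets are null for the variation because all their Borel subsets are null as well,
  and the second measure inherits this.\<close>

lemma indefinite_integral01_surj:
  assumes \<nu>: "finite_signed01 \<nu>" and ac: "null_on_null \<nu>"
  obtains g where "g \<in> borel_measurable borel" "set_integrable lebesgue {0..1} g" "indefinite_integral01 g = \<nu>"
proof -
  obtain N where N: "finite_measure N" "sets N = sets borel"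
    "\<And>A. A \<in> borel01 \<Longrightarrow> \<nu> A = measure (var_measure \<nu>) A - measure N A"
    and Nv: "\<And>A. A \<in> sets borel \<Longrightarrow> emeasure (var_measure \<nu>) A = 0 \<Longrightarrow> emeasure N A = 0"
    using finite_signed01_decomposition[OF \<nu>] by metis
  have acv: "emeasure (var_measure \<nu>) A = 0" if A: "A \<in> sets borel" "emeasure lborel A = 0" for A
  proof -
    have "var_on \<nu> (A \<inter> {0..1}) \<le> 0"
    proof (rule var_on_least)
      fix P assume P: "finite P" "P \<subseteq> borel01" "disjoint P" "\<Union> P \<subseteq> A \<inter> {0..1}"
      have "\<nu> B = 0" if "B \<in> P" for B
      proof -
        have "B \<subseteq> A" "B \<in> borel01" using P that by auto
        then have "emeasure lborel B = 0" using emeasure_mono[of B A lborel] A by simp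
        then show ?thesis using ac \<open>B \<in> borel01\<close> by (simp add: null_on_null_def)
      qed
      then show "(\<Sum>B\<in>P. ennreal \<bar>\<nu> B\<bar>) \<le> 0" by simp
    qed
    then show ?thesis using A by (simp add: emeasure_var_measure[OF \<nu>])
  qed
  obtain g where g: "g \<in> borel_measurable borel" "integrable lborel g"
      "\<And>A. A \<in> sets borel \<Longrightarrow> measure (var_measure \<nu>) A = (LINT x:A|lborel. g x)"
    using finite_measure_Radon_Nikodym_real[OF finite_var_measure[OF \<nu>] sets_var_measure acv] by metis
  obtain k where k: "k \<in> borel_measurable borel" "integrable lborel k"
      "\<And>A. A \<in> sets borel \<Longrightarrow> measure N A = (LINT x:A|lborel. k x)"
    using finite_measure_Radon_Nikodym_real[OF N(1,2) Nv[OF _ acv]] by metis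
  let ?f = "\<lambda>x. g x - k x"
  have gk: "?f \<in> borel_measurable borel" using g k by (intro borel_measurable_diff)
  have gk': "(\<lambda>x. indicator A x *\<^sub>R ?f x) \<in> borel_measurable lborel" if "A \<in> sets borel" for A
    using gk that by simp
  have ind: "integrable lborel (\<lambda>x. indicator A x *\<^sub>R f x)" if "A \<in> sets borel" "integrable lborel f" for A and f :: "real \<Rightarrow> real"
    using that by (intro integrable_mult_indicator) auto
  show thesis
  proof (rule that[OF gk])
    have "integrable lborel (\<lambda>x. indicator {0..1} x *\<^sub>R ?f x)"
      using g k by (intro ind Bochner_Integration.integrable_diff) auto
    then show "set_integrable lebesgue {0..1} ?f"
      unfolding set_integrable_def by (subst integrable_completion[OF gk']) auto
    show "indefinite_integral01 ?f = \<nu>"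
    proof
      fix A
      show "indefinite_integral01 ?f A = \<nu> A"
      proof (cases "A \<in> borel01")
        case True
        note A = borel01_sets[OF True]
        have "indefinite_integral01 ?f A = (LINT x|lborel. indicator A x *\<^sub>R ?f x)"
          using True by (simp only: indefinite_integral01_def set_lebesgue_integral_def integral_completion[OF gk'[OF A]] if_True)
        also have "\<dots> = (LINT x:A|lborel. g x) - (LINT x:A|lborel. k x)"
          unfolding set_lebesgue_integral_def
          using Bochner_Integration.integral_diff[OF ind[OF A g(2)] ind[OF A k(2)]] by (simp add: right_diff_distrib)
        also have "\<dots> = \<nu> A" using A N(3)[OF True] g(3) k(3) by simp
        finally show ?thesis .
      qed (simp add: indefinite_integral01_def finite_signed01_outside[OF \<nu>])
    qed
  qed
qed

section \<open>Dyadic blocks of a Cesaro function\<close>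

lemma ceiling_log2_eq_iff:
  assumes "0 < t"
  shows "\<lceil>log 2 t\<rceil> = m \<longleftrightarrow> 2 powr (real_of_int m - 1) < t \<and> t \<le> 2 powr (real_of_int m)"
  using assms by (simp add: ceiling_eq_iff less_log_iff log_le_iff)

text \<open>\<open>r\<close> is the right end point of a block and \<open>s = 0\<close> corresponds
  to its left end point; the slope \<open>r / 2\<close> is the block length, which gives the factor
  \<open>2 / r\<close> in \<open>dilate_measurable\<close>.\<close>

definition dilate :: "real \<Rightarrow> (real \<Rightarrow> real) \<Rightarrow> real \<Rightarrow> real" where
  "dilate r f s = f (r / 2 + r / 2 * s)"

text \<open>An affine change of variables. Measurability is assumed of
  \<open>indicator I t * f t\<close> because \<open>f\<close> is arbitrary off
  \<open>I\<close>.\<close>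

lemma dilate_measurable:
  assumes r: "0 < r" and f: "(\<lambda>t. indicator I t * f t) \<in> borel_measurable lebesgue" and I: "{r / 2..r} \<subseteq> I"
  shows "(\<lambda>s. indicator {0..1} s * dilate r f s) \<in> borel_measurable lebesgue"
    and "(\<integral>\<^sup>+s\<in>{0..1}. ennreal \<bar>dilate r f s\<bar> \<partial>lebesgue)
       = ennreal (2 / r) * (\<integral>\<^sup>+t\<in>{r / 2..r}. ennreal \<bar>f t\<bar> \<partial>lebesgue)"
proof -
  let ?a = "\<lambda>s::real. r / 2 + r / 2 * s"
  define h where "h t = indicator {r / 2..r} t * (indicator I t * f t)" for t
  have h: "h \<in> borel_measurable lebesgue"
    unfolding h_def by (intro borel_measurable_times[OF borel_measurable_indicator f]) simp
  have mem: "?a s \<in> {r / 2..r} \<longleftrightarrow> s \<in> {0..1}" for s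
  proof -
    have "0 \<le> r / 2 * s \<longleftrightarrow> 0 \<le> s" "r / 2 * s \<le> r / 2 \<longleftrightarrow> s \<le> 1"
      using r mult_le_cancel_left_pos[of "r / 2" s 1] by (auto simp: zero_le_mult_iff)
    then show ?thesis by auto
  qed
  then have "h (?a s) = indicator {0..1} s * (indicator I (?a s) * f (?a s))" for s
    unfolding h_def indicator_def by presburger
  moreover have "?a s \<in> I" if "s \<in> {0..1}" for s using mem that I by blast
  ultimately have ha: "h (?a s) = indicator {0..1} s * dilate r f s" for s
    by (cases "s \<in> {0..1}") (simp_all only: dilate_def indicator_simps, simp_all)
  have "?a \<in> lebesgue \<rightarrow>\<^sub>M lebesgue"
    using lebesgue_affine_measurable[of "\<lambda>_. r / 2" "r / 2 :: real"] r by simp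
  from measurable_compose[OF this h]
  show "(\<lambda>s. indicator {0..1} s * dilate r f s) \<in> borel_measurable lebesgue" by (simp only: ha)
  have "(\<integral>\<^sup>+t\<in>{r / 2..r}. ennreal \<bar>f t\<bar> \<partial>lebesgue) = (\<integral>\<^sup>+t. ennreal \<bar>h t\<bar> \<partial>lebesgue)"
    using I by (intro nn_integral_cong) (auto simp: h_def indicator_def)
  also have "\<dots> = ennreal \<bar>r / 2\<bar> * (\<integral>\<^sup>+s. ennreal \<bar>h (?a s)\<bar> \<partial>lebesgue)"
    using h r by (intro nn_integral_real_affine_lebesgue) auto
  also have "(\<integral>\<^sup>+s. ennreal \<bar>h (?a s)\<bar> \<partial>lebesgue) = (\<integral>\<^sup>+s\<in>{0..1}. ennreal \<bar>dilate r f s\<bar> \<partial>lebesgue)"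
    unfolding ha by (intro nn_integral_cong) (auto simp: indicator_def)
  finally show "(\<integral>\<^sup>+s\<in>{0..1}. ennreal \<bar>dilate r f s\<bar> \<partial>lebesgue)
       = ennreal (2 / r) * (\<integral>\<^sup>+t\<in>{r / 2..r}. ennreal \<bar>f t\<bar> \<partial>lebesgue)"
    using r by (simp add: mult.assoc[symmetric] ennreal_mult[symmetric])
qed

text \<open>The positive part of \<open>I\<close> is cut into the dyadic blocks with right end points \<open>2 powr e k\<close>; each
  block is dilated to the unit interval and the restriction of \<open>f\<close> is identified with its indefinite
  integral, which does not distinguish functions that agree almost everywhere.\<close>

locale dyadic_blocks =
  fixes I :: "real set" and e :: "nat \<Rightarrow> int" and d :: "int \<Rightarrow> nat"
  assumes d_e: "d (e k) = k"
    and I_sets: "I \<in> sets borel"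
    and I_down: "x \<in> I \<Longrightarrow> 0 < x \<Longrightarrow> {0..x} \<subseteq> I"
    and e_I: "2 powr real_of_int (e k) \<in> I"
    and e_d: "x \<in> I \<Longrightarrow> 0 < x \<Longrightarrow> i \<le> \<lceil>log 2 x\<rceil> \<Longrightarrow> e (d i) = i"
begin

definition radius :: "nat \<Rightarrow> real" where "radius k = 2 powr real_of_int (e k)"

definition blocks :: "(real \<Rightarrow> real) \<Rightarrow> nat \<Rightarrow> real set \<Rightarrow> real" where
  "blocks f k = indefinite_integral01 (dilate (radius k) f)"

definition block_norm :: "(real \<Rightarrow> real) \<Rightarrow> ennreal" where
  "block_norm f = (SUP k. \<integral>\<^sup>+s\<in>{0..1}. ennreal \<bar>dilate (radius k) f s\<bar> \<partial>lebesgue)"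

abbreviation I_measurable :: "(real \<Rightarrow> real) \<Rightarrow> bool" where
  "I_measurable f \<equiv> (\<lambda>t. indicator I t * f t) \<in> borel_measurable lebesgue"

lemma radius_pos: "0 < radius k" and radius_I: "radius k \<in> I"
  using e_I by (auto simp: radius_def)

lemma block_subset: "{radius k / 2..radius k} \<subseteq> I"
proof -
  have "{radius k / 2..radius k} \<subseteq> {0..radius k}" using radius_pos[of k] by auto
  then show ?thesis using I_down[OF radius_I radius_pos] by blast
qed

section \<open>Equivalence of the Cesaro norm with the block norm\<close>

lemma Ces_inf_iff: "f \<in> Ces_inf I \<longleftrightarrow> I_measurable f \<and> ces_norm I f < \<infinity>"
  using I_sets by (simp add: Ces_inf_def borel_measurable_restrict_space_iff)

lemma dilate_nn_integral:
  assumes "I_measurable f"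
  shows "(\<integral>\<^sup>+s\<in>{0..1}. ennreal \<bar>dilate (radius k) f s\<bar> \<partial>lebesgue)
       = ennreal (2 / radius k) * (\<integral>\<^sup>+t\<in>{radius k / 2..radius k}. ennreal \<bar>f t\<bar> \<partial>lebesgue)"
  by (rule dilate_measurable[OF radius_pos assms block_subset])

text \<open>A block is the upper half of \<open>{0..r}\<close>, so the mean over it is at most twice
  the mean over the whole interval.\<close>

lemma block_norm_le: assumes f: "I_measurable f" shows "block_norm f \<le> 2 * ces_norm I f"
  unfolding block_norm_def
proof (rule SUP_least)
  fix k
  let ?r = "radius k"
  have "(\<integral>\<^sup>+t\<in>{?r / 2..?r}. ennreal \<bar>f t\<bar> \<partial>lebesgue) \<le> (\<integral>\<^sup>+t\<in>{0..?r}. ennreal \<bar>f t\<bar> \<partial>lebesgue)"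
    using radius_pos[of k] by (intro nn_integral_mono) (auto simp: indicator_def)
  then have "ennreal (2 / ?r) * (\<integral>\<^sup>+t\<in>{?r / 2..?r}. ennreal \<bar>f t\<bar> \<partial>lebesgue)
      \<le> 2 * (ennreal (1 / ?r) * (\<integral>\<^sup>+t\<in>{0..?r}. ennreal \<bar>f t\<bar> \<partial>lebesgue))"
    using radius_pos[of k] ennreal_mult[of 2 "1 / ?r"]
    by (simp add: mult.assoc[symmetric] mult_left_mono)
  also have "\<dots> \<le> 2 * ces_norm I f"
    unfolding ces_norm_def using radius_pos radius_I by (intro mult_left_mono SUP_upper) auto
  finally show "(\<integral>\<^sup>+s\<in>{0..1}. ennreal \<bar>dilate ?r f s\<bar> \<partial>lebesgue) \<le> 2 * ces_norm I f"
    by (simp only: dilate_nn_integral[OF f])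
qed

text \<open>The interval up to \<open>x\<close> is covered by blocks with right ends
  \<open>2 powr (n - i)\<close>, and the integral of \<open>|f|\<close> over such a block is at most
  half its right end times \<open>block_norm f\<close>. The geometric series sums to
  \<open>2 powr n\<close>, which is less than \<open>2 * x\<close>.\<close>

lemma ces_norm_le: assumes f: "I_measurable f" shows "ces_norm I f \<le> 2 * block_norm f"
  unfolding ces_norm_def
proof (rule SUP_least)
  fix x assume "x \<in> {x \<in> I. 0 < x}"
  then have x: "x \<in> I" "0 < x" by auto
  define n where "n = \<lceil>log 2 x\<rceil>"
  have xn: "2 powr (real_of_int n - 1) < x" "x \<le> 2 powr real_of_int n"
    using ceiling_log2_eq_iff[OF x(2), of n] by (auto simp: n_def)
  \<comment> \<open>Left-open blocks make the cover disjoint; only the point 0 is missed, a null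
    set.\<close>
  define B where "B i = {2 powr (real_of_int (n - int i) - 1)<..2 powr real_of_int (n - int i)}" for i :: nat
  have B_iff: "t \<in> B i \<longleftrightarrow> 0 < t \<and> \<lceil>log 2 t\<rceil> = n - int i" for t i
  proof (cases "0 < t")
    case True
    then show ?thesis using ceiling_log2_eq_iff[OF True, of "n - int i"] by (simp add: B_def)
  next
    case False
    have "0 < 2 powr (real_of_int (n - int i) - 1)" by simp
    with False show ?thesis unfolding B_def greaterThanAtMost_iff by linarith
  qed
  have disj: "disjoint_family B" by (auto simp: disjoint_family_on_def B_iff)
  have cover: "t \<in> (\<Union>i. B i)" if t: "0 < t" "t \<le> x" for t
  proof -
    have "\<lceil>log 2 t\<rceil> \<le> n" unfolding n_def using t by (intro ceiling_mono) simp
    then have "t \<in> B (nat (n - \<lceil>log 2 t\<rceil>))" using t by (simp add: B_iff)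
    then show ?thesis by blast
  qed
  let ?F = "\<lambda>t. ennreal \<bar>indicator I t * f t\<bar>"
  have F: "?F \<in> borel_measurable lebesgue" using f by simp
  have "(\<integral>\<^sup>+t\<in>{0..x}. ennreal \<bar>f t\<bar> \<partial>lebesgue) \<le> (\<integral>\<^sup>+t\<in>(\<Union>i. B i). ?F t \<partial>lebesgue)"
  proof (rule nn_integral_mono_AE)
    have "AE t in lebesgue. t \<noteq> (0::real)" by (intro AE_completion AE_lborel_singleton)
    then show "AE t in lebesgue. ennreal \<bar>f t\<bar> * indicator {0..x} t \<le> ?F t * indicator (\<Union>i. B i) t"
    proof eventually_elim
      case (elim t)
      show ?case
      proof (cases "t \<in> {0..x}")
        case True
        then have "t \<in> I" "t \<in> (\<Union>i. B i)" using I_down[OF x] cover[of t] elim by auto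
        then show ?thesis by (simp add: indicator_def)
      qed simp
    qed
  qed
  also have "\<dots> = (\<Sum>i. \<integral>\<^sup>+t\<in>B i. ?F t \<partial>lebesgue)"
    by (rule nn_integral_disjoint_family[OF F _ disj]) (simp add: B_def)
  also have "\<dots> \<le> (\<Sum>i. ennreal (2 powr real_of_int n * (1 / 2) ^ Suc i) * block_norm f)"
  proof (rule suminf_le)
    fix i
    define k where "k = d (n - int i)"
    have ek: "e k = n - int i" unfolding k_def by (rule e_d[OF x]) (simp add: n_def)
    have r: "radius k = 2 powr real_of_int n * (1 / 2) ^ i"
      unfolding radius_def ek by (simp add: powr_diff powr_realpow power_one_over field_simps)
    have sub: "B i \<subseteq> {radius k / 2..radius k}"
      unfolding B_def radius_def ek by (auto simp: powr_diff)
    have "(\<integral>\<^sup>+t\<in>B i. ?F t \<partial>lebesgue) \<le> (\<integral>\<^sup>+t\<in>{radius k / 2..radius k}. ennreal \<bar>f t\<bar> \<partial>lebesgue)"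
      using sub by (intro nn_integral_mono) (auto simp: indicator_def)
    also have "\<dots> = ennreal (radius k / 2) * (ennreal (2 / radius k) * (\<integral>\<^sup>+t\<in>{radius k / 2..radius k}. ennreal \<bar>f t\<bar> \<partial>lebesgue))"
      using radius_pos[of k] by (simp add: mult.assoc[symmetric] ennreal_mult[symmetric])
    also have "\<dots> = ennreal (radius k / 2) * (\<integral>\<^sup>+s\<in>{0..1}. ennreal \<bar>dilate (radius k) f s\<bar> \<partial>lebesgue)"
      by (simp only: dilate_nn_integral[OF f])
    also have "\<dots> \<le> ennreal (radius k / 2) * block_norm f"
      unfolding block_norm_def by (intro mult_left_mono SUP_upper) auto
    finally show "(\<integral>\<^sup>+t\<in>B i. ?F t \<partial>lebesgue) \<le> ennreal (2 powr real_of_int n * (1 / 2) ^ Suc i) * block_norm f"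
      by (simp add: r)
  qed auto
  also have "\<dots> = (\<Sum>i. ennreal (2 powr real_of_int n * (1 / 2) ^ Suc i)) * block_norm f"
    by simp
  also have "(\<Sum>i. ennreal (2 powr real_of_int n * (1 / 2) ^ Suc i)) = ennreal (2 powr real_of_int n)"
    using sums_mult[OF power_half_series, of "2 powr real_of_int n"]
    by (intro suminf_ennreal_eq) auto
  finally have "ennreal (1 / x) * (\<integral>\<^sup>+t\<in>{0..x}. ennreal \<bar>f t\<bar> \<partial>lebesgue)
      \<le> ennreal (1 / x) * (ennreal (2 powr real_of_int n) * block_norm f)"
    by (rule mult_left_mono) simp
  also have "\<dots> = ennreal (2 powr real_of_int n / x) * block_norm f"
    using x by (simp add: mult.assoc[symmetric] ennreal_mult[symmetric])
  also have "\<dots> \<le> ennreal 2 * block_norm f"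
  proof (intro mult_right_mono ennreal_leI)
    show "2 powr real_of_int n / x \<le> 2" using xn(1) x(2) by (simp add: powr_diff field_simps)
  qed simp
  finally show "ennreal (1 / x) * (\<integral>\<^sup>+t\<in>{0..x}. ennreal \<bar>f t\<bar> \<partial>lebesgue) \<le> 2 * block_norm f" by simp
qed

lemma set_integrable_dilate:
  assumes f: "I_measurable f" and fin: "block_norm f < \<infinity>"
  shows "set_integrable lebesgue {0..1} (dilate (radius k) f)"
  unfolding set_integrable_def
proof (rule integrableI_bounded)
  show "(\<lambda>s. indicator {0..1} s *\<^sub>R dilate (radius k) f s) \<in> borel_measurable lebesgue"
    using dilate_measurable(1)[OF radius_pos f block_subset] by simp
  have "(\<integral>\<^sup>+s. ennreal (norm (indicator {0..1} s *\<^sub>R dilate (radius k) f s)) \<partial>lebesgue)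
      = (\<integral>\<^sup>+s\<in>{0..1}. ennreal \<bar>dilate (radius k) f s\<bar> \<partial>lebesgue)"
    by (intro nn_integral_cong) (auto simp: indicator_def)
  also have "\<dots> \<le> block_norm f" unfolding block_norm_def by (rule SUP_upper) simp
  finally show "(\<integral>\<^sup>+s. ennreal (norm (indicator {0..1} s *\<^sub>R dilate (radius k) f s)) \<partial>lebesgue) < \<infinity>"
    using fin by (rule le_less_trans)
qed

lemma linf_blocks:
  assumes f: "I_measurable f" and fin: "block_norm f < \<infinity>"
  shows "linf ac_norm (blocks f) = block_norm f"
  using indefinite_integral01[OF set_integrable_dilate[OF assms]]
  by (simp add: linf_def blocks_def ac_norm_def block_norm_def)

lemma blocks_linear:
  assumes f: "I_measurable f" "block_norm f < \<infinity>" and g: "I_measurable g" "block_norm g < \<infinity>"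
  shows "blocks (\<lambda>x. a * f x + b * g x) = a *\<^sub>R blocks f + b *\<^sub>R blocks g"
proof (intro ext)
  fix k A
  show "blocks (\<lambda>x. a * f x + b * g x) k A = (a *\<^sub>R blocks f + b *\<^sub>R blocks g) k A"
  proof (cases "A \<in> borel01")
    case True
    let ?f = "dilate (radius k) f" and ?g = "dilate (radius k) g"
    have "set_integrable lebesgue A ?f" "set_integrable lebesgue A ?g"
      using True set_integrable_dilate[OF f, of k] set_integrable_dilate[OF g, of k]
      by (auto intro!: set_integrable_subset[of lebesgue "{0..1}"] simp: borel01_def)
    moreover have "dilate (radius k) (\<lambda>x. a * f x + b * g x) = (\<lambda>s. a * ?f s + b * ?g s)"
      by (simp add: dilate_def fun_eq_iff)
    ultimately show ?thesis
      using True by (simp add: blocks_def indefinite_integral01_def set_integral_add)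
  qed (simp add: blocks_def indefinite_integral01_def)
qed

text \<open>The densities of the single measures are glued together: on the block with index
  \<open>k\<close> the function is the density of \<open>\<nu> k\<close>, transported by the inverse
  \<open>t \<mapsto> 2 * t / radius k - 1\<close> of the dilation.\<close>

lemma blocks_surj:
  assumes \<nu>: "linf ac_norm \<nu> < \<infinity>"
  obtains f where "f \<in> Ces_inf I" "blocks f = \<nu>"
proof -
  have \<nu>k: "finite_signed01 (\<nu> k)" "null_on_null (\<nu> k)" for k
    using linf_nth_finite[OF \<nu>, of k] unfolding ac_norm_finite_iff by auto
  have "\<exists>g. g \<in> borel_measurable borel \<and> set_integrable lebesgue {0..1} g \<and> indefinite_integral01 g = \<nu> k" for k
    using indefinite_integral01_surj[OF \<nu>k] by metis
  then obtain g where g: "\<And>k. g k \<in> borel_measurable borel" "\<And>k. set_integrable lebesgue {0..1} (g k)"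
      "\<And>k. indefinite_integral01 (g k) = \<nu> k" by metis
  define f where "f t = g (d \<lceil>log 2 t\<rceil>) (2 * t / radius (d \<lceil>log 2 t\<rceil>) - 1)" for t
  have f: "f \<in> borel_measurable borel"
    unfolding f_def
  proof (rule measurable_compose_countable)
    show "(\<lambda>t. g i (2 * t / radius i - 1)) \<in> borel_measurable borel" for i
      by (rule measurable_compose[OF _ g(1)]) simp
    have "(\<lambda>t. \<lceil>log 2 t\<rceil>) \<in> borel \<rightarrow>\<^sub>M count_space UNIV" by simp
    from measurable_compose[OF this] show "(\<lambda>t. d \<lceil>log 2 t\<rceil>) \<in> borel \<rightarrow>\<^sub>M count_space UNIV" by simp
  qed
  have leb: "h \<in> borel_measurable lebesgue" if "h \<in> borel_measurable borel" for h :: "real \<Rightarrow> real"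
    using that by (simp add: measurable_completion)
  have fI: "I_measurable f" using f I_sets by (intro leb borel_measurable_times) auto
  \<comment> \<open>For \<open>s = 0\<close> the argument is the left end of the block, which
    belongs to the next smaller block; hence the agreement is only almost everywhere.\<close>
  have eq: "dilate (radius k) f s = g k s" if s: "s \<in> {0..1}" "s \<noteq> 0" for k s
  proof -
    let ?t = "radius k / 2 + radius k / 2 * s"
    have s': "0 < s" "s \<le> 1" using s by auto
    have r: "0 < radius k / 2 * s" "radius k / 2 * s \<le> radius k / 2"
      using s' radius_pos[of k] mult_left_mono[of s 1 "radius k / 2"] by auto
    then have t: "radius k / 2 < ?t" "?t \<le> radius k" by auto
    then have "0 < ?t" using radius_pos[of k] by linarith
    moreover have "radius k / 2 = 2 powr (real_of_int (e k) - 1)" by (simp add: radius_def powr_diff)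
    ultimately have "\<lceil>log 2 ?t\<rceil> = e k" using t by (simp add: ceiling_log2_eq_iff radius_def)
    moreover have "2 * ?t / radius k - 1 = s" using radius_pos[of k] by (simp add: field_simps)
    ultimately show ?thesis by (simp add: dilate_def f_def d_e)
  qed
  have ae: "AE s in lebesgue. s \<noteq> (0::real)" by (intro AE_completion AE_lborel_singleton)
  have "(\<integral>\<^sup>+s\<in>{0..1}. ennreal \<bar>dilate (radius k) f s\<bar> \<partial>lebesgue) = (\<integral>\<^sup>+s\<in>{0..1}. ennreal \<bar>g k s\<bar> \<partial>lebesgue)" for k
    by (rule nn_integral_cong_AE) (use ae in \<open>eventually_elim, auto simp: indicator_def eq\<close>)
  also have "\<dots> k = ac_norm (\<nu> k)" for k
    using indefinite_integral01(3)[OF g(2)[of k]] \<nu>k[of k] by (simp add: g(3) ac_norm_def)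
  finally have "block_norm f = linf ac_norm \<nu>" by (simp add: block_norm_def linf_def)
  then have fin: "block_norm f < \<infinity>" using \<nu> by simp
  have "ces_norm I f < \<infinity>"
    by (rule le_less_trans[OF ces_norm_le[OF fI]]) (use fin in \<open>simp add: ennreal_mult_less_top\<close>)
  then have "f \<in> Ces_inf I" using fI by (simp only: Ces_inf_iff)
  moreover have "blocks f = \<nu>"
  proof
    fix k
    have "indefinite_integral01 (dilate (radius k) f) A = indefinite_integral01 (g k) A" for A
    proof (cases "A \<in> borel01")
      case True
      have [measurable]: "A \<in> sets borel" "f \<in> borel_measurable borel" "g k \<in> borel_measurable borel"
        using borel01_sets[OF True] f g by auto
      have "(LINT s|lebesgue. indicator A s *\<^sub>R dilate (radius k) f s) = (LINT s|lebesgue. indicator A s *\<^sub>R g k s)"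
      proof (rule integral_cong_AE)
        show "AE s in lebesgue. indicator A s *\<^sub>R dilate (radius k) f s = indicator A s *\<^sub>R g k s"
          using ae by eventually_elim (use borel01_subset[OF True] in \<open>auto simp: indicator_def eq\<close>)
        show "(\<lambda>s. indicator A s *\<^sub>R dilate (radius k) f s) \<in> borel_measurable lebesgue"
          unfolding dilate_def by (rule leb) measurable
        show "(\<lambda>s. indicator A s *\<^sub>R g k s) \<in> borel_measurable lebesgue"
          by (rule leb) measurable
      qed
      then show ?thesis by (simp add: indefinite_integral01_def set_lebesgue_integral_def)
    qed (simp add: indefinite_integral01_def)
    then show "blocks f k = \<nu> k" by (auto simp: blocks_def g(3)[symmetric])
  qed
  ultimately show thesis by (rule that)
qed

lemma block_norm_finite: "f \<in> Ces_inf I \<Longrightarrow> I_measurable f \<and> block_norm f < \<infinity>"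
  using block_norm_le[of f] by (auto simp: Ces_inf_iff ennreal_mult_less_top intro: le_less_trans)

end

text \<open>A single space of measures is complemented in \<open>linf ac_norm\<close>; taking sums,
  \<open>linf M_norm\<close> is complemented in \<open>linf (linf ac_norm)\<close>, which is
  \<open>linf ac_norm\<close> again.\<close>

lemma isomorphic_linf_ac_linf_M: "isomorphic (linf ac_norm) (linf M_norm)"
  by (intro linf_decomposition ext_norm_ac_norm ext_norm_M_norm complemented_linf complemented_ac_M
      complemented_isomorphic[OF complemented_linf[OF complemented_M_linf_ac] isomorphic_linf_linf])

theorem theorem14:
  fixes I :: "real set"
  assumes "I = {0..1} \<or> I = {0..}"
  shows "\<exists>(T :: (real \<Rightarrow> real) \<Rightarrow> (nat \<Rightarrow> real set \<Rightarrow> real)) (c::real) (C::real).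
           0 < c \<and> 0 < C \<and>
           (\<forall>f\<in>Ces_inf I. T f \<in> linf_M01) \<and>
           linf_M01 \<subseteq> T ` Ces_inf I \<and>
           (\<forall>f\<in>Ces_inf I. \<forall>g\<in>Ces_inf I. \<forall>a b::real.
              T (\<lambda>x. a * f x + b * g x) = (\<lambda>k A. a * T f k A + b * T g k A)) \<and>
           (\<forall>f\<in>Ces_inf I. ennreal c * ces_norm I f \<le> linf_norm (T f) \<and>
                           linf_norm (T f) \<le> ennreal C * ces_norm I f)"
proof -
  \<comment> \<open>The block exponents are the nonpositive integers for the unit interval and all
    integers for the half-line; either set is enumerated by \<open>nat\<close>.\<close>
  have "\<exists>e d. dyadic_blocks I e d"
    using assms
  proof
    assume I: "I = {0..1}"
    have "dyadic_blocks I (\<lambda>k. - int k) (\<lambda>i. nat (- i))"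
    proof
      fix k show "2 powr real_of_int (- int k) \<in> I" using powr_mono[of "- real k" 0 2] by (simp add: I)
    next
      fix x i assume x: "x \<in> I" "0 < x" "i \<le> \<lceil>log 2 x\<rceil>"
      then have "\<lceil>log 2 x\<rceil> \<le> 0" by (simp add: I)
      then show "- int (nat (- i)) = i" using x(3) by linarith
    qed (auto simp: I)
    then show ?thesis by blast
  next
    assume I: "I = {0..}"
    have "dyadic_blocks I int_decode int_encode"
      by standard (auto simp: I)
    then show ?thesis by blast
  qed
  then obtain e d where "dyadic_blocks I e d" by blast
  then interpret dyadic_blocks I e d .
  obtain T S where T: "bounded_op (linf ac_norm) (linf M_norm) T" and S: "bounded_op (linf M_norm) (linf ac_norm) S"
    and ST: "\<And>x. linf ac_norm x < \<infinity> \<Longrightarrow> S (T x) = x"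
    and TS: "\<And>y. linf M_norm y < \<infinity> \<Longrightarrow> T (S y) = y"
    using isomorphic_linf_ac_linf_M unfolding isomorphic_def by metis
  obtain C where C: "0 \<le> C" "\<And>x. linf ac_norm x < \<infinity> \<Longrightarrow> linf M_norm (T x) \<le> ennreal C * linf ac_norm x"
    by (rule bounded_op_bound[OF T]) blast
  obtain D where D: "0 \<le> D" "\<And>y. linf M_norm y < \<infinity> \<Longrightarrow> linf ac_norm (S y) \<le> ennreal D * linf M_norm y"
    by (rule bounded_op_bound[OF S]) blast
  have B: "linf ac_norm (blocks f) < \<infinity>" "linf ac_norm (blocks f) = block_norm f" if "f \<in> Ces_inf I" for f
    using block_norm_finite[OF that] linf_blocks[of f] by auto
  have TB: "linf M_norm (T (blocks f)) < \<infinity>" if "f \<in> Ces_inf I" for f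
    by (rule bounded_op_finite[OF T]) (rule B[OF that])
  have TB': "T (blocks f) \<in> linf_M01" "linf_norm (T (blocks f)) = linf M_norm (T (blocks f))" if "f \<in> Ces_inf I" for f
    using TB[OF that] linf_M01_iff linf_norm_eq by blast+
  have factor: "ennreal x * (2 * (ennreal y * z)) = ennreal (x * (2 * y)) * z"
    if "0 \<le> x" "0 \<le> y" for x y :: real and z :: ennreal
    using that by (simp add: ennreal_mult mult.assoc)
  show ?thesis
  \<comment> \<open>The factors 2 come from comparing the Cesaro norm with the block norm; adding 1
    keeps the constants positive even if \<open>C\<close> or \<open>D\<close> is 0.\<close>
  proof (rule exI[of _ "\<lambda>f. T (blocks f)"], rule exI[of _ "1 / (2 * (D + 1))"],
      rule exI[of _ "2 * (C + 1)"], intro conjI ballI allI)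
    show "0 < 1 / (2 * (D + 1))" "0 < 2 * (C + 1)" using C D by auto
    show "T (blocks f) \<in> linf_M01" if "f \<in> Ces_inf I" for f by (rule TB'[OF that])
    show "linf_M01 \<subseteq> (\<lambda>f. T (blocks f)) ` Ces_inf I"
    proof
      fix y assume "y \<in> linf_M01"
      then have y: "linf M_norm y < \<infinity>" by (simp only: linf_M01_iff)
      have "linf ac_norm (S y) < \<infinity>" by (rule bounded_op_finite[OF S]) (rule y)
      then obtain f where "f \<in> Ces_inf I" "blocks f = S y" by (rule blocks_surj)
      then show "y \<in> (\<lambda>f. T (blocks f)) ` Ces_inf I" using TS[OF y] by (intro image_eqI[of _ _ f]) auto
    qed
  next
    fix f g a b assume f: "f \<in> Ces_inf I" and g: "g \<in> Ces_inf I"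
    have "T (blocks (\<lambda>x. a * f x + b * g x)) = T (a *\<^sub>R blocks f + b *\<^sub>R blocks g)"
      using block_norm_finite[OF f] block_norm_finite[OF g] by (simp add: blocks_linear)
    also have "\<dots> = T (a *\<^sub>R blocks f) + T (b *\<^sub>R blocks g)"
      by (rule bounded_op_add[OF T]) (rule ext_norm_scaleR_finite[OF ext_norm_linf[OF ext_norm_ac_norm]], rule B, fact)+
    also have "\<dots> = a *\<^sub>R T (blocks f) + b *\<^sub>R T (blocks g)"
      using bounded_op_scaleR[OF T, OF B(1)[OF f]] bounded_op_scaleR[OF T, OF B(1)[OF g]] by simp
    finally show "T (blocks (\<lambda>x. a * f x + b * g x)) = (\<lambda>k A. a * T (blocks f) k A + b * T (blocks g) k A)"
      by (simp add: fun_eq_iff)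
  next
    fix f assume f: "f \<in> Ces_inf I"
    note fm = block_norm_finite[OF f]
    have "linf ac_norm (blocks f) \<le> ennreal D * linf M_norm (T (blocks f))"
      using D(2)[OF TB[OF f]] ST[OF B(1)[OF f]] by simp
    also have "\<dots> \<le> ennreal (D + 1) * linf M_norm (T (blocks f))"
      by (intro mult_right_mono ennreal_leI) auto
    finally have "ces_norm I f \<le> 2 * (ennreal (D + 1) * linf M_norm (T (blocks f)))"
      using fm B(2)[OF f] by (intro order_trans[OF ces_norm_le mult_left_mono]) auto
    then have "ennreal (1 / (2 * (D + 1))) * ces_norm I f
        \<le> ennreal (1 / (2 * (D + 1))) * (2 * (ennreal (D + 1) * linf M_norm (T (blocks f))))"
      by (rule mult_left_mono) simp
    also have "\<dots> = ennreal (1 / (2 * (D + 1)) * (2 * (D + 1))) * linf M_norm (T (blocks f))"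
      using D(1) by (intro factor) auto
    also have "\<dots> = linf_norm (T (blocks f))" using D(1) TB'[OF f] by simp
    finally show "ennreal (1 / (2 * (D + 1))) * ces_norm I f \<le> linf_norm (T (blocks f))" .
    have "linf_norm (T (blocks f)) \<le> ennreal C * linf ac_norm (blocks f)"
      using C(2)[OF B(1)[OF f]] TB'[OF f] by simp
    also have "\<dots> \<le> ennreal (C + 1) * (2 * ces_norm I f)"
      using block_norm_le[of f] fm B(2)[OF f] by (intro mult_mono ennreal_leI) auto
    also have "\<dots> = ennreal 1 * (2 * (ennreal (C + 1) * ces_norm I f))"
      by (simp only: ennreal_1 mult_1_left mult.left_commute)
    also have "\<dots> = ennreal (1 * (2 * (C + 1))) * ces_norm I f"
      using C(1) by (intro factor) auto
    finally show "linf_norm (T (blocks f)) \<le> ennreal (2 * (C + 1)) * ces_norm I f"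
      by (simp only: mult_1_left)
  qed
qed

end
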